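(* Let $I$ and $J$ be sets, and let $(X_i)_{i\in I}$ and $(Y_j)_{j\in J}$ be random variables on a common probability space, the $\sigma$-metalgebra they span being denoted by $\mathcal M$. Suppose that for all $i\in I$, $j\in J$ one has $\{X_i:Y_j\}_{\mathcal M}\le\epsilon_{ij}$ for some $\epsilon_{ij}\ge0$, and define the operator $$\boldsymbol\epsilon:L^2(J)\to L^2(I),\qquad (a_j)_{j\in J}\mapsto\Big(\sum_{j\in J}\epsilon_{ij}a_j\Big)_{i\in I}.$$ Then, writing $\vec X_I=(X_i)_{i\in I}$, $\vec Y_J=(Y_j)_{j\in J}$ and $\|\boldsymbol\epsilon\|$ for the operator norm of $\boldsymbol\epsilon$, $$\{\vec X_I:\vec Y_J\}\ \le\ \min(\|\boldsymbol\epsilon\|,1).$$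
   Context: $L^2(I)$ is the Hilbert space of square-summable real families indexed by $I$ (operator norm $+\infty$ if $\boldsymbol\epsilon$ does not define a bounded operator). Random variables may take values in arbitrary measurable spaces. For random variables $X,Y$ the Hilbertian (maximal) correlation coefficient is $\{X:Y\}=\{\sigma(X):\sigma(Y)\}$ where, for $\sigma$-algebras $\mathcal F,\mathcal G$, $\{\mathcal F:\mathcal G\}$ is the supremum of $|\operatorname{Cov}(f,g)|/(\operatorname{sd}(f)\operatorname{sd}(g))$ over real square-integrable, not a.s. constant $f$ ($\mathcal F$-measurable) and $g$ ($\mathcal G$-measurable) ($0$ if one of the $\sigma$-algebras is trivial; $\operatorname{sd}$ is the standard deviation). Subjective correlation: for $\sigma$-algebras $\mathcal F,\mathcal G,\mathcal H$, $\{\mathcal F:\mathcal G\}_{\mathcal H}$ is the smallest $\epsilon\in[0,1]$ such that $|\mathbf E[fg]|\le\epsilon\operatorname{sd}(f)\operatorname{sd}(g)$ for all real square-integrable $f$ ($\mathcal F\vee\mathcal H$-measurable) and $g$ ($\mathcal G\vee\mathcal H$-measurable) with $\mathbf E[f|\mathcal H]=\mathbf E[g|\mathcal H]=0$ a.s. (for variables $X,Y,Z$ this says $\{X:Y\}\le\epsilon$ under the conditional law given $Z=z$ for almost all $z$). The $\sigma$-metalgebra spanned by random variables $(Z_k)_{k\in K}$ is the set $\mathcal M$ of the $\sigma$-algebras $\sigma((Z_k)_{k\in K'})$, $K'\subset K$, and $\{X:Y\}_{\mathcal M}=\sup_{\mathcal H\in\mathcal M}\{\sigma(X):\sigma(Y)\}_{\mathcal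 H}$. Here the spanning family consists of all the $X_i$ and all the $Y_j$. *)

theory Defs
  imports "HOL-Probability.Probability"
begin

text \<open>
  A sub-\<sigma>-algebra of \<open>M\<close> is represented by a measure on the same space, of which only \<open>space\<close>
  and \<open>sets\<close> matter. In particular \<open>\<sigma>(X)\<close>, for a random variable \<open>X\<close> with values in \<open>N\<close>, is
  \<open>vimage_algebra (space M) X N\<close>.
\<close>

definition sd :: "'a measure \<Rightarrow> ('a \<Rightarrow> real) \<Rightarrow> real" where
  "sd M f = sqrt (prob_space.variance M f)"

definition covar :: "'a measure \<Rightarrow> ('a \<Rightarrow> real) \<Rightarrow> ('a \<Rightarrow> real) \<Rightarrow> real" where
  "covar M f g = prob_space.expectation M
     (\<lambda>x. (f x - prob_space.expectation M f) * (g x - prob_space.expectation M g))"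

definition sq_integrable :: "'a measure \<Rightarrow> 'a measure \<Rightarrow> ('a \<Rightarrow> real) set" where
  "sq_integrable M F = {f \<in> borel_measurable F. integrable M (\<lambda>x. (f x)\<^sup>2)}"

definition as_const :: "'a measure \<Rightarrow> ('a \<Rightarrow> real) \<Rightarrow> bool" where
  "as_const M f \<longleftrightarrow> (\<exists>c. AE x in M. f x = c)"

text \<open>
  Triviality is meant up to null sets: this is exactly the case in which every real
  \<open>F\<close>-measurable function is almost surely constant, so that the supremum below would range
  over the empty set.
\<close>

definition trivial_alg :: "'a measure \<Rightarrow> 'a measure \<Rightarrow> bool" where
  "trivial_alg M F \<longleftrightarrow> (\<forall>A\<in>sets F. measure M A = 0 \<or> measure M A = 1)"

definition max_corr :: "'a measure \<Rightarrow> 'a measure \<Rightarrow> 'a measure \<Rightarrow> real" where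
  "max_corr M F G =
     (if trivial_alg M F \<or> trivial_alg M G then 0
      else Sup {\<bar>covar M f g\<bar> / (sd M f * sd M g) | f g.
                  f \<in> sq_integrable M F \<and> \<not> as_const M f \<and>
                  g \<in> sq_integrable M G \<and> \<not> as_const M g})"

definition join_alg :: "'a measure \<Rightarrow> 'k set \<Rightarrow> ('k \<Rightarrow> 'a measure) \<Rightarrow> 'a measure" where
  "join_alg M K F = sigma (space M) (\<Union>k\<in>K. sets (F k))"

definition join2_alg :: "'a measure \<Rightarrow> 'a measure \<Rightarrow> 'a measure \<Rightarrow> 'a measure" where
  "join2_alg M F H = sigma (space M) (sets F \<union> sets H)"

definition subj_corr :: "'a measure \<Rightarrow> 'a measure \<Rightarrow> 'a measure \<Rightarrow> 'a measure \<Rightarrow> real" where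
  "subj_corr M H F G = (LEAST e::real. 0 \<le> e \<and> e \<le> 1 \<and>
     (\<forall>f \<in> sq_integrable M (join2_alg M F H). \<forall>g \<in> sq_integrable M (join2_alg M G H).
        (AE x in M. real_cond_exp M H f x = 0) \<longrightarrow>
        (AE x in M. real_cond_exp M H g x = 0) \<longrightarrow>
        \<bar>prob_space.expectation M (\<lambda>x. f x * g x)\<bar> \<le> e * sd M f * sd M g))"

text \<open>
  The spanning random variables \<open>Z k\<close>, \<open>k \<in> K\<close>, enter through the \<sigma>-algebras
  \<open>F k = \<sigma>(Z k)\<close>. This allows variables with values in different types to span together.
\<close>

definition metalgebra :: "'a measure \<Rightarrow> 'k set \<Rightarrow> ('k \<Rightarrow> 'a measure) \<Rightarrow> 'a measure set" where
  "metalgebra M K F = {join_alg M K' F | K'. K' \<subseteq> K}"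

definition meta_corr :: "'a measure \<Rightarrow> 'a measure set \<Rightarrow> 'a measure \<Rightarrow> 'a measure \<Rightarrow> real" where
  "meta_corr M \<M> F G = (SUP H\<in>\<M>. subj_corr M H F G)"

text \<open>
  The space \<open>L\<^sup>2(J)\<close> for an arbitrary index set \<open>J\<close>; only the values on \<open>J\<close> are relevant.
\<close>

definition l2 :: "'j set \<Rightarrow> ('j \<Rightarrow> real) set" where
  "l2 J = {a. (\<lambda>j. (a j)\<^sup>2) summable_on J}"

definition l2_norm :: "'j set \<Rightarrow> ('j \<Rightarrow> real) \<Rightarrow> real" where
  "l2_norm J a = sqrt (\<Sum>\<^sub>\<infinity>j\<in>J. (a j)\<^sup>2)"

definition mat_op :: "'j set \<Rightarrow> ('i \<Rightarrow> 'j \<Rightarrow> real) \<Rightarrow> ('j \<Rightarrow> real) \<Rightarrow> ('i \<Rightarrow> real)" where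
  "mat_op J e a = (\<lambda>i. \<Sum>\<^sub>\<infinity>j\<in>J. e i j * a j)"

text \<open>
  The operator norm of the matrix \<open>e\<close> from \<open>L\<^sup>2(J)\<close> to \<open>L\<^sup>2(I)\<close>. It is \<open>\<infinity>\<close> if some defining series
  does not converge or some image is not square-summable; if the operator is everywhere
  defined but unbounded, the supremum in the extended reals is \<open>\<infinity>\<close> by itself.
\<close>

definition mat_onorm :: "'i set \<Rightarrow> 'j set \<Rightarrow> ('i \<Rightarrow> 'j \<Rightarrow> real) \<Rightarrow> ereal" where
  "mat_onorm I J e =
     (if \<forall>a\<in>l2 J. (\<forall>i\<in>I. (\<lambda>j. e i j * a j) summable_on J) \<and> mat_op J e a \<in> l2 I
      then (SUP a\<in>{a\<in>l2 J. l2_norm J a \<le> 1}. ereal (l2_norm I (mat_op J e a)))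
      else \<infinity>)"

end

theory Submission
  imports Defs
begin

text \<open>
  By \<open>L\<^sup>2\<close>-approximation \<open>I\<close> and \<open>J\<close> may be taken finite. For a centred \<open>\<sigma>(Y)\<close>-measurable \<open>g\<close> put
  \<open>V i j = E[(E[g | X\<^sub>k, Y\<^sub>l, k < i, l < j])\<^sup>2]\<close>; one has to show \<open>V N 0 \<le> s\<^sup>2 * V 0 M\<close> for every \<open>s < 1\<close>
  above the norm of \<open>\<epsilon>\<close>. The increments of \<open>V\<close> along the edges of the grid are energies, which are
  conserved when a monotone path is moved across a cell, and the hypothesis on the pair \<open>(i, j)\<close>
  bounds the amplitude that crosses the cell: \<open>x' \<le> x + \<epsilon>\<^sub>i\<^sub>j * y\<close>. Moving the path cell by cell from
  ``first \<open>Y\<close>, then \<open>X\<close>'' to ``first \<open>X\<close>, then \<open>Y\<close>'', a weighted sum of the energies along it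
  never increases, if the weights are built from vectors \<open>u, v\<close> that pass the Schur test
  \<open>\<epsilon> v < s u\<close>, \<open>\<epsilon>\<^sup>T u \<le> s v\<close>: a column starts with weight \<open>s\<^sup>2\<close> and loses \<open>s u\<^sub>i \<epsilon>\<^sub>i\<^sub>j / v\<^sub>j\<close> at row \<open>i\<close>,
  and a row which has met the columns \<open>j \<ge> k\<close> has a weight of about \<open>s u\<^sub>i / (\<Sum>j\<ge>k. \<epsilon>\<^sub>i\<^sub>j v\<^sub>j)\<close>.
\<close>

section \<open>Energies on a grid\<close>

text \<open>This is a converse of the Schur test. Taking \<open>u = (1 + E v) / s\<close> makes the
  row condition strict, and the column condition turns into
  \<open>T E v + T 1 \<le> s\<^sup>2 * v\<close>, where \<open>E\<close> is the matrix and
  \<open>T\<close> its transpose. Since \<open>T E / s\<^sup>2\<close> is a contraction, a truncated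
  Neumann series solves it.\<close>

lemma schur_weights:
  fixes e :: "'i \<Rightarrow> 'j \<Rightarrow> real"
  assumes fin: "finite I" "finite J"
    and e: "\<And>i j. i \<in> I \<Longrightarrow> j \<in> J \<Longrightarrow> 0 \<le> e i j"
    and bound: "\<And>a. L2_set (\<lambda>i. \<Sum>j\<in>J. e i j * a j) I \<le> S * L2_set a J"
    and S: "0 \<le> S" "S < s"
  obtains u v where "\<And>j. j \<in> J \<Longrightarrow> 0 < v j"
    "\<And>i. i \<in> I \<Longrightarrow> (\<Sum>j\<in>J. e i j * v j) < s * u i"
    "\<And>j. j \<in> J \<Longrightarrow> (\<Sum>i\<in>I. e i j * u i) \<le> s * v j"
proof -
  define E where "E a i = (\<Sum>j\<in>J. e i j * a j)" for a i
  define T where "T a j = (\<Sum>i\<in>I. e i j * a i)" for a j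
  have s: "0 < s" using S by simp
  \<comment> \<open>Duality: the square of the norm of \<open>T a\<close> is the inner product of
    \<open>a\<close> with \<open>E (T a)\<close>. Cauchy-Schwarz and the bound on \<open>E\<close>
    leave one norm of \<open>T a\<close> to cancel.\<close>
  have T_bound: "L2_set (T a) J \<le> S * L2_set a I" for a
  proof -
    have "(L2_set (T a) J)\<^sup>2 = (\<Sum>j\<in>J. T a j * T a j)"
      by (simp add: L2_set_def sum_nonneg power2_eq_square)
    also have "\<dots> = (\<Sum>j\<in>J. \<Sum>i\<in>I. e i j * a i * T a j)"
      by (simp add: T_def[of a] sum_distrib_right)
    also have "\<dots> = (\<Sum>i\<in>I. a i * E (T a) i)"
      unfolding E_def by (subst sum.swap) (simp add: sum_distrib_left mult_ac)
    also have "\<dots> \<le> (\<Sum>i\<in>I. \<bar>a i\<bar> * \<bar>E (T a) i\<bar>)"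
      by (intro sum_mono) (metis abs_ge_self abs_mult)
    also have "\<dots> \<le> L2_set a I * L2_set (E (T a)) I"
      by (rule L2_set_mult_ineq)
    also have "\<dots> \<le> L2_set a I * (S * L2_set (T a) J)"
      unfolding E_def by (intro mult_left_mono bound) simp
    finally have "L2_set (T a) J * L2_set (T a) J \<le> (S * L2_set a I) * L2_set (T a) J"
      by (simp add: power2_eq_square mult_ac)
    then show ?thesis
      using S by (cases "L2_set (T a) J = 0") (auto simp: less_le)
  qed
  \<comment> \<open>\<open>v\<close> is the Neumann series of \<open>(1 - T E / s\<^sup>2) v = c\<close>, cut off once the next term is at most 1:
    the constant 1 in \<open>c\<close> absorbs the error.\<close>
  define c where "c j = 1 + T (\<lambda>_. 1) j / s\<^sup>2" for j
  define w where "w n = ((\<lambda>a j. T (E a) j / s\<^sup>2) ^^ n) c" for n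
  have w_Suc: "w (Suc n) j = T (E (w n)) j / s\<^sup>2" for n j by (simp add: w_def)
  have w_norm: "L2_set (w n) J \<le> ((S / s)\<^sup>2) ^ n * L2_set c J" for n
  proof (induction n)
    case 0
    show ?case by (simp add: w_def)
  next
    case (Suc n)
    have "L2_set (w (Suc n)) J = inverse (s\<^sup>2) * L2_set (T (E (w n))) J"
      by (simp add: w_Suc[abs_def] L2_set_right_distrib divide_inverse mult.commute)
    also have "\<dots> \<le> inverse (s\<^sup>2) * (S * (S * L2_set (w n) J))"
      using S by (intro mult_left_mono order_trans[OF T_bound]) (auto simp: E_def[abs_def] intro: bound)
    also have "\<dots> = (S / s)\<^sup>2 * L2_set (w n) J"
      by (simp add: power2_eq_square field_simps)
    also have "\<dots> \<le> (S / s)\<^sup>2 * (((S / s)\<^sup>2) ^ n * L2_set c J)"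
      by (intro mult_left_mono Suc) simp
    finally show ?case by (simp add: mult_ac)
  qed
  have "(S / s)\<^sup>2 < 1" using S s by (simp add: power_less_one_iff abs_square_less_1)
  then have "(\<lambda>n. ((S / s)\<^sup>2) ^ n * L2_set c J) \<longlonglongrightarrow> 0"
    by (intro tendsto_mult_left_zero LIMSEQ_realpow_zero) auto
  then have "eventually (\<lambda>n. ((S / s)\<^sup>2) ^ n * L2_set c J < 1) sequentially"
    by (rule order_tendstoD) simp
  \<comment> \<open>The choice \<open>n \<ge> 1\<close> keeps the term \<open>w 0 = c\<close> in the
    sum \<open>v\<close>, which makes \<open>v\<close> positive.\<close>
  then obtain n where n: "((S / s)\<^sup>2) ^ n * L2_set c J < 1" "n \<ge> 1"
    using eventually_ge_at_top[of "1::nat"] eventually_happens'[OF sequentially_bot]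
    by (metis (no_types, lifting) eventually_conj)
  have w_le: "w n j \<le> 1" if "j \<in> J" for j
    using member_le_L2_set[OF fin(2) that, of "w n"] w_norm[of n] n(1) by linarith
  have T_nonneg: "0 \<le> T a j" if "j \<in> J" "\<And>i. i \<in> I \<Longrightarrow> 0 \<le> a i" for a j
    unfolding T_def using that e by (intro sum_nonneg mult_nonneg_nonneg) auto
  have E_nonneg: "0 \<le> E a i" if "i \<in> I" "\<And>j. j \<in> J \<Longrightarrow> 0 \<le> a j" for a i
    unfolding E_def using that e by (intro sum_nonneg mult_nonneg_nonneg) auto
  have c1: "1 \<le> c j" if "j \<in> J" for j
    using T_nonneg[OF that, of "\<lambda>_. 1"] by (simp add: c_def)
  have w_nonneg: "0 \<le> w k j" if "j \<in> J" for k j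
    using that
  proof (induction k arbitrary: j)
    case 0
    then show ?case using c1[of j] by (simp add: w_def)
  next
    case (Suc k)
    then show ?case by (auto simp: w_Suc intro!: divide_nonneg_nonneg T_nonneg E_nonneg)
  qed
  define v where "v j = (\<Sum>k<n. w k j)" for j
  define u where "u i = (1 + E v i) / s" for i
  have E_v: "E v i = (\<Sum>k<n. E (w k) i)" for i
    unfolding E_def v_def sum_distrib_left by (rule sum.swap)
  have T_E_v: "T (E v) j = (\<Sum>k<n. T (E (w k)) j)" for j
    unfolding T_def E_v sum_distrib_left by (rule sum.swap)
  show ?thesis
  proof
    fix j assume j: "j \<in> J"
    have "w 0 j \<le> v j"
      unfolding v_def using n w_nonneg j by (intro member_le_sum) auto
    then show "0 < v j" using c1[OF j] by (simp add: w_def)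
    \<comment> \<open>Applying \<open>T E / s\<^sup>2\<close> to \<open>v\<close> shifts the partial
      sum by one index, so the defect is the single term \<open>w n j\<close>, at most the 1
      contained in \<open>c j\<close>.\<close>
    have "T (E v) j / s\<^sup>2 + c j = (\<Sum>k<n. w (Suc k) j) + w 0 j"
      by (simp add: T_E_v w_Suc sum_divide_distrib) (simp add: w_def)
    also have "\<dots> = v j + w n j"
      unfolding v_def using sum.lessThan_Suc_shift[of "\<lambda>k. w k j" n] by simp
    finally have *: "T (E v) j / s\<^sup>2 + T (\<lambda>_. 1) j / s\<^sup>2 \<le> v j"
      using w_le[OF j] by (simp add: c_def)
    have "(\<Sum>i\<in>I. e i j * u i) = T u j" by (simp add: T_def)
    also have "\<dots> = (T (\<lambda>_. 1) j + T (E v) j) / s"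
      by (simp add: T_def u_def distrib_left sum.distrib add_divide_distrib sum_divide_distrib)
    also have "\<dots> = s * (T (E v) j / s\<^sup>2 + T (\<lambda>_. 1) j / s\<^sup>2)"
      using s by (simp add: field_simps power2_eq_square)
    also have "\<dots> \<le> s * v j" using * s by (intro mult_left_mono) auto
    finally show "(\<Sum>i\<in>I. e i j * u i) \<le> s * v j" .
  next
    fix i assume "i \<in> I"
    show "(\<Sum>j\<in>J. e i j * v j) < s * u i"
      using s by (simp add: u_def E_def)
  qed
qed

section \<open>Transport of energy through the rows of the grid\<close>

text \<open>Cauchy-Schwarz for the splitting of \<open>x\<close> as
  \<open>sqrt h * (x / sqrt h)\<close> and of \<open>e * y\<close> as
  \<open>sqrt (e * v) * (sqrt (e / v) * y)\<close>; the gap between the two sides is an explicit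
  square.\<close>

lemma weighted_square_le:
  fixes x y e v h :: real
  assumes "0 < h" "0 < v" "0 \<le> e"
  shows "(x + e * y)\<^sup>2 \<le> (h + e * v) * (x\<^sup>2 / h + e * y\<^sup>2 / v)"
proof -
  have "(h + e * v) * (x\<^sup>2 / h + e * y\<^sup>2 / v) - (x + e * y)\<^sup>2 = e * (v * x - h * y)\<^sup>2 / (h * v)"
    using assms by (simp add: field_simps power2_eq_square)
  moreover have "\<dots> \<ge> 0" using assms by simp
  ultimately show ?thesis by linarith
qed

text \<open>
  Here \<open>b * xx k\<close> carries the energy of the row accumulated from the columns \<open>j \<ge> k\<close>, and \<open>al\<close>, \<open>al'\<close>
  are the weights of the column energies before and after the row is swept. The weight \<open>b \<ge> 1\<close> of
  the row dominates \<open>al\<close>, so energy flowing back from the row to a column does no harm.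
\<close>

lemma row_potential:
  fixes xx yy yy' e v al al' :: "nat \<Rightarrow> real" and kap eta :: real
  assumes xx: "\<And>k. 0 \<le> xx k" and yy: "\<And>k. 0 \<le> yy k" and yy': "\<And>k. 0 \<le> yy' k"
    and energy: "\<And>k. k < M \<Longrightarrow> xx k + yy' k = xx (Suc k) + yy k"
    and last: "xx M = 0"
    and corner: "\<And>k. k < M \<Longrightarrow> sqrt (xx k) \<le> sqrt (xx (Suc k)) + e k * sqrt (yy k)"
    and e: "\<And>k. k < M \<Longrightarrow> 0 \<le> e k" and v: "\<And>k. k < M \<Longrightarrow> 0 < v k" and eta: "0 < eta"
    and al': "\<And>k. k < M \<Longrightarrow> 0 \<le> al' k" and al: "\<And>k. k < M \<Longrightarrow> al k \<le> 1"
    and step: "\<And>k. k < M \<Longrightarrow> al k - al' k = kap * e k / v k"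
    and "k \<le> M" "1 \<le> b" "b * (eta + (\<Sum>j=k..<M. e j * v j)) \<le> kap"
  shows "b * xx k + (\<Sum>j=k..<M. al' j * yy' j) \<le> (\<Sum>j=k..<M. al j * yy j)"
  using \<open>k \<le> M\<close> \<open>1 \<le> b\<close> \<open>b * (eta + (\<Sum>j=k..<M. e j * v j)) \<le> kap\<close>
\<comment> \<open>The induction runs from column \<open>M\<close> down to \<open>k\<close>. The row
  weight \<open>b\<close> is generalized because it may change at every column; the bound by
  \<open>kap\<close> is the budget that limits it.\<close>
proof (induction k arbitrary: b rule: inc_induct)
  case base
  then show ?case by (simp add: last)
next
  case (step k)
  define h where "h = eta + (\<Sum>j=Suc k..<M. e j * v j)"
  have h: "0 < h"
    unfolding h_def using e v eta by (intro add_pos_nonneg sum_nonneg) (auto intro!: mult_nonneg_nonneg simp: less_imp_le)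
  have ek: "0 \<le> e k" and vk: "0 < v k" using step.hyps e v by auto
  have bk: "b * (h + e k * v k) \<le> kap"
    using step.prems(2) step.hyps by (simp add: h_def sum.atLeast_Suc_lessThan algebra_simps)
  have h_le: "b * h \<le> b * (h + e k * v k)"
    using step.prems ek vk by (intro mult_left_mono) auto
  have kap: "0 \<le> kap"
    using h_le bk h step.prems by (smt (verit) mult_nonneg_nonneg)
  \<comment> \<open>\<open>assms(12)\<close> is the weight drop
    \<open>al k - al' k = kap * e k / v k\<close>, nonnegative together with
    \<open>kap\<close>.\<close>
  have al_k: "al' k \<le> al k"
    using assms(12)[OF step.hyps(2)] kap ek vk by (smt (verit) divide_nonneg_nonneg mult_nonneg_nonneg)
  have en: "xx k + yy' k = xx (Suc k) + yy k" using step.hyps energy by simp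
  have main: "\<exists>b2\<ge>1. b2 * h \<le> kap \<and> b * xx k + al' k * yy' k \<le> b2 * xx (Suc k) + al k * yy k"
  proof (cases "xx k \<le> xx (Suc k)")
    case True
    have "al' k \<le> b" using al_k al[OF step.hyps(2)] step.prems by simp
    then have "al' k * (xx (Suc k) - xx k) \<le> b * (xx (Suc k) - xx k)"
      using True by (intro mult_right_mono) auto
    moreover have "al' k * yy' k = al' k * (xx (Suc k) - xx k) + al' k * yy k"
    proof -
      have "yy' k = (xx (Suc k) - xx k) + yy k" using en by simp
      then show ?thesis by (simp only: distrib_left)
    qed
    moreover have "al' k * yy k \<le> al k * yy k" using al_k yy by (intro mult_right_mono) auto
    ultimately have "b * xx k + al' k * yy' k \<le> b * xx (Suc k) + al k * yy k"
      by (simp add: algebra_simps)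
    with step.prems(1) order_trans[OF h_le bk] show ?thesis by blast
  next
    case False
    \<comment> \<open>With this choice \<open>b2 * h = b * (h + e k * v k)\<close>, so the budget
      passes unchanged to the next column. Cauchy-Schwarz with weights \<open>h\<close> and
      \<open>e k * v k\<close> puts the coefficient \<open>b2\<close> on \<open>xx (Suc k)\<close>
      and at most \<open>kap * e k / v k\<close> on \<open>yy k\<close>, which is exactly the weight
      that the column gives up.\<close>
    define b2 where "b2 = b * (h + e k * v k) / h"
    have "b \<le> b2" using h_le h by (simp add: b2_def field_simps)
    have "al' k * yy' k \<le> al' k * yy k"
      using False en al'[OF step.hyps(2)] by (intro mult_left_mono) auto
    moreover have "b * xx k \<le> b2 * xx (Suc k) + (al k - al' k) * yy k"
    proof -
      have "xx k = (sqrt (xx k))\<^sup>2" using xx by simp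
      also have "\<dots> \<le> (sqrt (xx (Suc k)) + e k * sqrt (yy k))\<^sup>2"
        using corner[OF step.hyps(2)] xx by (intro power_mono) auto
      also have "\<dots> \<le> (h + e k * v k) * (xx (Suc k) / h + e k * yy k / v k)"
        using weighted_square_le[OF h vk ek, of "sqrt (xx (Suc k))" "sqrt (yy k)"] xx yy by simp
      finally have "b * xx k \<le> b * ((h + e k * v k) * (xx (Suc k) / h + e k * yy k / v k))"
        using step.prems by (intro mult_left_mono) auto
      also have "\<dots> = b2 * xx (Suc k) + b * (h + e k * v k) * (e k * yy k / v k)"
      proof -
        have "b * (Z * (xx (Suc k) / h + W)) = b * Z / h * xx (Suc k) + b * Z * W" for Z W
          by (simp add: algebra_simps)
        then show ?thesis by (simp add: b2_def)
      qed
      also have "\<dots> \<le> b2 * xx (Suc k) + kap * (e k * yy k / v k)"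
        using bk ek vk yy by (intro add_left_mono mult_right_mono) auto
      also have "\<dots> = b2 * xx (Suc k) + (al k - al' k) * yy k"
        using assms(12)[OF step.hyps(2)] by simp
      finally show ?thesis .
    qed
    ultimately have "b * xx k + al' k * yy' k \<le> b2 * xx (Suc k) + al k * yy k"
      by (simp add: algebra_simps)
    moreover have "b2 * h \<le> kap" using bk h by (simp add: b2_def)
    moreover have "1 \<le> b2" using \<open>b \<le> b2\<close> step.prems by simp
    ultimately show ?thesis by blast
  qed
  then obtain b2 where b2: "1 \<le> b2" "b2 * h \<le> kap"
    "b * xx k + al' k * yy' k \<le> b2 * xx (Suc k) + al k * yy k" by blast
  have "b2 * xx (Suc k) + (\<Sum>j=Suc k..<M. al' j * yy' j) \<le> (\<Sum>j=Suc k..<M. al j * yy j)"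
    using step.IH[OF b2(1)] b2(2) by (simp add: h_def)
  then show ?case
    using b2(3) step.hyps by (simp add: sum.atLeast_Suc_lessThan)
qed

text \<open>One sweep per row by \<open>row_potential\<close>. The potential after \<open>n\<close>
  rows is the gain \<open>V n 0 - V 0 0\<close> plus the weighted column increments at row
  \<open>n\<close>. It starts at \<open>s\<^sup>2 * (V 0 M - V 0 0)\<close>, never increases, and
  ends no lower than \<open>V N 0 - V 0 0\<close>.\<close>

lemma grid_bound:
  fixes V :: "nat \<Rightarrow> nat \<Rightarrow> real" and e :: "nat \<Rightarrow> nat \<Rightarrow> real"
  assumes V1: "\<And>i j. V i j \<le> V (Suc i) j" and V2: "\<And>i j. V i j \<le> V i (Suc j)"
    and last: "\<And>i. i \<le> N \<Longrightarrow> V i M = V 0 M"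
    and corner: "\<And>i j. i < N \<Longrightarrow> j < M \<Longrightarrow>
      sqrt (V (Suc i) j - V i j)
        \<le> sqrt (V (Suc i) (Suc j) - V i (Suc j)) + e i j * sqrt (V i (Suc j) - V i j)"
    and e: "\<And>i j. i < N \<Longrightarrow> j < M \<Longrightarrow> 0 \<le> e i j"
    and s: "0 < s" "s \<le> 1"
    and v: "\<And>j. j < M \<Longrightarrow> 0 < v j"
    and u: "\<And>i. i < N \<Longrightarrow> (\<Sum>j<M. e i j * v j) < s * u i"
    and uv: "\<And>j. j < M \<Longrightarrow> (\<Sum>i<N. e i j * u i) \<le> s * v j"
  shows "V N 0 - V 0 0 \<le> s\<^sup>2 * (V 0 M - V 0 0)"
proof -
  \<comment> \<open>The column half \<open>uv\<close> of the Schur test amounts to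
    \<open>al N j \<ge> 0\<close>; the strict row half \<open>u\<close> supplies the positive
    \<open>eta\<close> of each sweep.\<close>
  define al where "al n j = s\<^sup>2 - s * (\<Sum>i<n. e i j * u i) / v j" for n j
  have u_pos: "0 < u i" if "i < N" for i
  proof -
    have "0 \<le> (\<Sum>j<M. e i j * v j)"
      using e v that by (intro sum_nonneg mult_nonneg_nonneg) (auto simp: less_imp_le)
    with u[OF that] have "0 < s * u i" by linarith
    then show ?thesis using s by (simp add: zero_less_mult_iff)
  qed
  have al_nonneg: "0 \<le> al n j" if "n \<le> N" "j < M" for n j
  proof -
    have "(\<Sum>i<n. e i j * u i) \<le> (\<Sum>i<N. e i j * u i)"
      using that e u_pos by (intro sum_mono2 mult_nonneg_nonneg) (auto simp: less_imp_le)
    then have "s * (\<Sum>i<n. e i j * u i) \<le> s * (s * v j)"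
      using uv[OF that(2)] s by (intro mult_left_mono) auto
    then show ?thesis using v[OF that(2)] by (simp add: al_def field_simps power2_eq_square)
  qed
  have al_le: "al n j \<le> 1" if "n \<le> N" "j < M" for n j
  proof -
    have "0 \<le> s * (\<Sum>i<n. e i j * u i) / v j"
      using that e u_pos v s
      by (intro divide_nonneg_nonneg mult_nonneg_nonneg sum_nonneg) (auto simp: less_imp_le)
    moreover have "s\<^sup>2 \<le> 1" using s by (simp add: power_le_one)
    ultimately show ?thesis by (simp add: al_def)
  qed
  have row: "V (Suc n) 0 - V n 0 + (\<Sum>j<M. al (Suc n) j * (V (Suc n) (Suc j) - V (Suc n) j))
      \<le> (\<Sum>j<M. al n j * (V n (Suc j) - V n j))" if n: "n < N" for n
  proof -
    have al_step: "al n k - al (Suc n) k = s * u n * e n k / v k" for k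
      by (simp add: al_def algebra_simps add_divide_distrib)
    have "1 * (V (Suc n) 0 - V n 0) + (\<Sum>j=0..<M. al (Suc n) j * (V (Suc n) (Suc j) - V (Suc n) j))
      \<le> (\<Sum>j=0..<M. al n j * (V n (Suc j) - V n j))"
    \<comment> \<open>\<open>eta\<close> is the slack of the row condition, so that for
      \<open>k = 0\<close> and \<open>b = 1\<close> the budget \<open>kap = s * u n\<close> is met
      with equality.\<close>
    proof (rule row_potential[where e = "e n" and v = v and kap = "s * u n"
            and xx = "\<lambda>k. V (Suc n) k - V n k" and eta = "s * u n - (\<Sum>j<M. e n j * v j)"])
      show "V (Suc n) M - V n M = 0" using last[of n] last[of "Suc n"] n by simp
      show "0 < s * u n - (\<Sum>j<M. e n j * v j)" using u[OF n] by simp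
    qed (use n V1 V2 corner e v al_nonneg al_le al_step in \<open>auto simp: lessThan_atLeast0\<close>)
    then show ?thesis by (simp add: lessThan_atLeast0)
  qed
  have "V n 0 - V 0 0 + (\<Sum>j<M. al n j * (V n (Suc j) - V n j))
      \<le> (\<Sum>j<M. al 0 j * (V 0 (Suc j) - V 0 j))" if "n \<le> N" for n
    using that
  proof (induction n)
    case (Suc n)
    then show ?case using row[of n] by simp
  qed simp
  from this[of N] have "V N 0 - V 0 0 + (\<Sum>j<M. al N j * (V N (Suc j) - V N j))
      \<le> (\<Sum>j<M. s\<^sup>2 * (V 0 (Suc j) - V 0 j))" by (simp add: al_def)
  moreover have "0 \<le> (\<Sum>j<M. al N j * (V N (Suc j) - V N j))"
    using al_nonneg V2 by (intro sum_nonneg mult_nonneg_nonneg) auto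
  moreover have "(\<Sum>j<M. s\<^sup>2 * (V 0 (Suc j) - V 0 j)) = s\<^sup>2 * (V 0 M - V 0 0)"
    by (simp add: sum_lessThan_telescope flip: sum_distrib_left)
  ultimately show ?thesis by linarith
qed

section \<open>Square-integrable functions and conditional expectations\<close>

context prob_space
begin

lemma sigma_finite_subalgebraI:
  assumes "subalgebra M F"
  shows "sigma_finite_subalgebra M F"
proof -
  interpret finite_measure_subalgebra M F by unfold_locales (rule assms)
  show ?thesis by unfold_locales
qed

section \<open>Vector space structure and Cauchy-Schwarz\<close>

lemma sq_integrableD:
  assumes "f \<in> sq_integrable M M"
  shows "f \<in> borel_measurable M" "integrable M (\<lambda>x. (f x)\<^sup>2)" "integrable M f"
proof -
  show *: "f \<in> borel_measurable M" "integrable M (\<lambda>x. (f x)\<^sup>2)"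
    using assms by (simp_all add: sq_integrable_def)
  show "integrable M f" using square_integrable_imp_integrable[OF *] .
qed

lemma sq_integrable_mono:
  assumes "subalgebra G F" "f \<in> sq_integrable M F"
  shows "f \<in> sq_integrable M G"
proof -
  have "f \<in> borel_measurable F" "integrable M (\<lambda>x. (f x)\<^sup>2)"
    using assms(2) by (simp_all add: sq_integrable_def)
  then show ?thesis
    unfolding sq_integrable_def using measurable_from_subalg[OF assms(1)] by blast
qed

lemma integrable_mult_sq_integrable:
  assumes "f \<in> sq_integrable M M" "g \<in> sq_integrable M M"
  shows "integrable M (\<lambda>x. f x * g x)"
proof (rule Bochner_Integration.integrable_bound)
  show "integrable M (\<lambda>x. (f x)\<^sup>2 + (g x)\<^sup>2)"
    by (intro Bochner_Integration.integrable_add sq_integrableD assms)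
  show "(\<lambda>x. f x * g x) \<in> borel_measurable M"
    by (intro borel_measurable_times sq_integrableD assms)
  have "norm (a * b) \<le> norm (a\<^sup>2 + b\<^sup>2)" for a b :: real
  proof -
    have "0 \<le> (\<bar>a\<bar> - \<bar>b\<bar>)\<^sup>2" by simp
    then have "2 * (\<bar>a\<bar> * \<bar>b\<bar>) \<le> a\<^sup>2 + b\<^sup>2" by (simp add: power2_eq_square algebra_simps)
    moreover have "0 \<le> \<bar>a\<bar> * \<bar>b\<bar>" by simp
    ultimately show ?thesis unfolding real_norm_def abs_mult by linarith
  qed
  then show "AE x in M. norm (f x * g x) \<le> norm ((f x)\<^sup>2 + (g x)\<^sup>2)" by simp
qed

lemma sq_integrable_cmult:
  assumes "f \<in> sq_integrable M F"
  shows "(\<lambda>x. c * f x) \<in> sq_integrable M F"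
proof -
  have f: "f \<in> borel_measurable F" "integrable M (\<lambda>x. (f x)\<^sup>2)"
    using assms by (simp_all add: sq_integrable_def)
  have "(\<lambda>x. c * f x) \<in> borel_measurable F" using f(1) by measurable
  moreover have "integrable M (\<lambda>x. c\<^sup>2 * (f x)\<^sup>2)"
    using f(2) by (intro integrable_mult_right)
  ultimately show ?thesis by (simp only: sq_integrable_def power_mult_distrib mem_Collect_eq simp_thms)
qed

lemma sq_integrable_add:
  assumes F: "subalgebra M F" and fg: "f \<in> sq_integrable M F" "g \<in> sq_integrable M F"
  shows "(\<lambda>x. f x + g x) \<in> sq_integrable M F"
proof -
  have "integrable M (\<lambda>x. (f x)\<^sup>2 + (g x)\<^sup>2 + 2 * (f x * g x))"
    by (intro Bochner_Integration.integrable_add integrable_mult_right sq_integrableD(2)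
        integrable_mult_sq_integrable sq_integrable_mono[OF F] fg)
  also have "(\<lambda>x. (f x)\<^sup>2 + (g x)\<^sup>2 + 2 * (f x * g x)) = (\<lambda>x. (f x + g x)\<^sup>2)"
    by (simp add: power2_eq_square algebra_simps)
  finally have "integrable M (\<lambda>x. (f x + g x)\<^sup>2)" .
  moreover have "(\<lambda>x. f x + g x) \<in> borel_measurable F"
    using fg by (intro borel_measurable_add) (simp_all add: sq_integrable_def)
  ultimately show ?thesis by (simp add: sq_integrable_def)
qed

lemma sq_integrable_diff:
  assumes "subalgebra M F" "f \<in> sq_integrable M F" "g \<in> sq_integrable M F"
  shows "(\<lambda>x. f x - g x) \<in> sq_integrable M F"
proof -
  have "(\<lambda>x. f x + (- 1) * g x) \<in> sq_integrable M F"
    by (intro sq_integrable_add sq_integrable_cmult assms)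
  then show ?thesis by simp
qed

lemma sq_integrable_const: "(\<lambda>x. c) \<in> sq_integrable M F"
  by (simp add: sq_integrable_def)

lemma sq_integrable_indicator:
  assumes "subalgebra M G" "A \<in> sets G"
  shows "indicator A \<in> sq_integrable M G"
proof -
  have "A \<in> sets M" using assms by (auto simp: subalgebra_def)
  moreover have "(indicator A x :: real)\<^sup>2 = indicator A x" for x by (simp add: indicator_def)
  moreover from \<open>A \<in> sets M\<close> have "integrable M (indicator A :: 'a \<Rightarrow> real)"
    by (rule integrable_real_indicator) (simp add: emeasure_eq_measure)
  ultimately show ?thesis
    using assms(2) by (simp add: sq_integrable_def)
qed

lemma subalgebra_self: "subalgebra M M" by (simp add: subalgebra_def)

lemma Cauchy_Schwarz_expectation:
  assumes f: "f \<in> sq_integrable M M" and g: "g \<in> sq_integrable M M"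
  shows "\<bar>expectation (\<lambda>x. f x * g x)\<bar>
    \<le> sqrt (expectation (\<lambda>x. (f x)\<^sup>2)) * sqrt (expectation (\<lambda>x. (g x)\<^sup>2))"
proof -
  let ?a = "expectation (\<lambda>x. (f x)\<^sup>2)" and ?b = "expectation (\<lambda>x. (g x)\<^sup>2)"
    and ?c = "expectation (\<lambda>x. f x * g x)"
  note int = sq_integrableD(2)[OF f] sq_integrableD(2)[OF g] integrable_mult_sq_integrable[OF f g]
  have nonneg: "0 \<le> ?a" "0 \<le> ?b" by simp_all
  have quad: "0 \<le> s\<^sup>2 * ?a + t\<^sup>2 * ?b + 2 * s * t * ?c" for s t :: real
  proof -
    have "0 \<le> expectation (\<lambda>x. (s * f x + t * g x)\<^sup>2)" by simp
    also have "\<dots> = expectation (\<lambda>x. s\<^sup>2 * (f x)\<^sup>2 + t\<^sup>2 * (g x)\<^sup>2 + 2 * s * t * (f x * g x))"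
      by (simp add: power2_eq_square algebra_simps)
    also have "\<dots> = s\<^sup>2 * ?a + t\<^sup>2 * ?b + 2 * s * t * ?c"
      using int by simp
    finally show ?thesis .
  qed
  have "?c\<^sup>2 \<le> ?a * ?b"
  proof (cases "?a = 0")
    case True
    have "?c = 0"
    proof (rule ccontr)
      assume "?c \<noteq> 0"
      \<comment> \<open>For \<open>?a = 0\<close> the quadratic form is linear in \<open>s\<close>;
        this value of \<open>s\<close> makes it \<open>?b - 2 * (?b + 1)\<close>, which is
        negative.\<close>
      then have "2 \<le> - ?b" using quad[of "- (?b + 1) / ?c" 1] True by simp
      with nonneg show False by linarith
    qed
    then show ?thesis using True by simp
  next
    case False
    \<comment> \<open>At \<open>s = ?c\<close> and \<open>t = - ?a\<close> the form equals
      \<open>?a * (?a * ?b - ?c\<^sup>2)\<close>.\<close>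
    have "0 \<le> ?c\<^sup>2 * ?a + ?a\<^sup>2 * ?b - 2 * ?c\<^sup>2 * ?a"
      using quad[of "?c" "- ?a"] by (simp add: power2_eq_square mult_ac)
    then have "?a * ?c\<^sup>2 \<le> ?a * (?a * ?b)" by (simp add: power2_eq_square algebra_simps)
    then show ?thesis using False nonneg by (simp add: less_le)
  qed
  then have "sqrt (?c\<^sup>2) \<le> sqrt (?a * ?b)" by (rule real_sqrt_le_mono)
  then show ?thesis by (simp add: real_sqrt_mult)
qed

section \<open>Conditional expectation as orthogonal projection\<close>

lemma cond_exp_sq_integrable:
  assumes F: "subalgebra M F" and g: "g \<in> sq_integrable M M"
  shows "real_cond_exp M F g \<in> sq_integrable M F"
proof -
  interpret F: sigma_finite_subalgebra M F by (rule sigma_finite_subalgebraI[OF F])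
  have "integrable M (\<lambda>x. (real_cond_exp M F g x)\<^sup>2)"
    using sq_integrableD[OF g] convex_power2
    by (intro F.integrable_convex_cond_exp[where I = UNIV]) auto
  then show ?thesis by (simp add: sq_integrable_def)
qed

lemma expectation_mult_cond_exp:
  assumes F: "subalgebra M F" and f: "f \<in> sq_integrable M F" and g: "g \<in> sq_integrable M M"
  shows "expectation (\<lambda>x. f x * real_cond_exp M F g x) = expectation (\<lambda>x. f x * g x)"
proof -
  interpret F: sigma_finite_subalgebra M F by (rule sigma_finite_subalgebraI[OF F])
  show ?thesis
    using f g sq_integrableD(1)[OF g] integrable_mult_sq_integrable[OF sq_integrable_mono[OF F f] g]
    by (intro F.real_cond_exp_intg(2)) (auto simp: sq_integrable_def)
qed

text \<open>Pythagoras for nested projections: the increment from \<open>F\<close> to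
  \<open>G\<close> is orthogonal to the projection on \<open>F\<close>. These increments are the
  energies on the edges of the grid.\<close>

lemma expectation_cond_exp_sq_diff:
  assumes G: "subalgebra M G" and F: "subalgebra G F" and g: "g \<in> sq_integrable M M"
  shows "expectation (\<lambda>x. (real_cond_exp M G g x - real_cond_exp M F g x)\<^sup>2)
      = expectation (\<lambda>x. (real_cond_exp M G g x)\<^sup>2) - expectation (\<lambda>x. (real_cond_exp M F g x)\<^sup>2)"
    and "expectation (\<lambda>x. real_cond_exp M F g x * real_cond_exp M G g x)
      = expectation (\<lambda>x. (real_cond_exp M F g x)\<^sup>2)"
proof -
  have F': "subalgebra M F" using F G by (auto simp: subalgebra_def)
  note cG = cond_exp_sq_integrable[OF G g] and cF = cond_exp_sq_integrable[OF F' g]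
  note iG = sq_integrable_mono[OF G cG] and iF = sq_integrable_mono[OF F' cF]
  show eq: "expectation (\<lambda>x. real_cond_exp M F g x * real_cond_exp M G g x)
      = expectation (\<lambda>x. (real_cond_exp M F g x)\<^sup>2)"
    using expectation_mult_cond_exp[OF G sq_integrable_mono[OF F cF] g]
      expectation_mult_cond_exp[OF F' cF g] by (simp add: power2_eq_square)
  have "(real_cond_exp M G g x - real_cond_exp M F g x)\<^sup>2 = (real_cond_exp M G g x)\<^sup>2
      + (real_cond_exp M F g x)\<^sup>2 - 2 * (real_cond_exp M F g x * real_cond_exp M G g x)" for x
    by (simp add: power2_eq_square algebra_simps)
  then show "expectation (\<lambda>x. (real_cond_exp M G g x - real_cond_exp M F g x)\<^sup>2)
      = expectation (\<lambda>x. (real_cond_exp M G g x)\<^sup>2) - expectation (\<lambda>x. (real_cond_exp M F g x)\<^sup>2)"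
    using eq sq_integrableD(2)[OF iG] sq_integrableD(2)[OF iF] integrable_mult_sq_integrable[OF iF iG]
    by simp
qed

text \<open>Makes increments of conditional expectations admissible as test functions for the
  subjective correlation given \<open>F\<close>. The vanishing mean also turns their
  \<open>sd\<close> into an L2 norm.\<close>

lemma cond_exp_increment_centered:
  assumes G: "subalgebra M G" and F: "subalgebra G F" and g: "g \<in> sq_integrable M M"
  shows "AE x in M. real_cond_exp M F (\<lambda>x. real_cond_exp M G g x - real_cond_exp M F g x) x = 0"
    and "expectation (\<lambda>x. real_cond_exp M G g x - real_cond_exp M F g x) = 0"
proof -
  have F': "subalgebra M F" using F G by (auto simp: subalgebra_def)
  interpret F: sigma_finite_subalgebra M F by (rule sigma_finite_subalgebraI[OF F'])
  interpret G: sigma_finite_subalgebra M G by (rule sigma_finite_subalgebraI[OF G])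
  note ig = sq_integrableD(3)[OF g]
  show "expectation (\<lambda>x. real_cond_exp M G g x - real_cond_exp M F g x) = 0"
    using F.real_cond_exp_int[OF ig] G.real_cond_exp_int[OF ig] by simp
  have "AE x in M. real_cond_exp M F (\<lambda>x. real_cond_exp M G g x - real_cond_exp M F g x) x
      = real_cond_exp M F (real_cond_exp M G g) x - real_cond_exp M F (real_cond_exp M F g) x"
    using F.real_cond_exp_int[OF ig] G.real_cond_exp_int[OF ig] by (intro F.real_cond_exp_diff)
  moreover have "AE x in M. real_cond_exp M F (real_cond_exp M G g) x = real_cond_exp M F g x"
    using ig G F by (intro F.real_cond_exp_nested_subalg)
  moreover have "AE x in M. real_cond_exp M F (real_cond_exp M F g) x = real_cond_exp M F g x"
    using F.real_cond_exp_int[OF ig] by (intro F.real_cond_exp_F_meas) auto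
  ultimately show "AE x in M. real_cond_exp M F (\<lambda>x. real_cond_exp M G g x - real_cond_exp M F g x) x = 0"
    by eventually_elim simp
qed

text \<open>
  With \<open>HX\<close>, \<open>HY\<close>, \<open>HXY\<close> generated by \<open>H\<close> together with \<open>X\<close>, with \<open>Y\<close>, or with both: only the pair of
  increments of \<open>g\<close> over \<open>H\<close> is controlled by the subjective correlation, and the rest is what
  \<open>X\<close> explains after \<open>Y\<close>.
\<close>

lemma corner_inequality:
  fixes g :: "'a \<Rightarrow> real"
  defines "V \<equiv> \<lambda>F. expectation (\<lambda>x. (real_cond_exp M F g x)\<^sup>2)"
  assumes HXY: "subalgebra M HXY" and HX: "subalgebra HXY HX" and HY: "subalgebra HXY HY"
    and H: "subalgebra HX H" "subalgebra HY H"
    and g: "g \<in> sq_integrable M M"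
    and e: "0 \<le> e"
    and corr: "\<And>p q. p \<in> sq_integrable M HX \<Longrightarrow> q \<in> sq_integrable M HY \<Longrightarrow>
      AE x in M. real_cond_exp M H p x = 0 \<Longrightarrow> AE x in M. real_cond_exp M H q x = 0 \<Longrightarrow>
      \<bar>expectation (\<lambda>x. p x * q x)\<bar> \<le> e * sd M p * sd M q"
  shows "sqrt (V HX - V H) \<le> sqrt (V HXY - V HY) + e * sqrt (V HY - V H)"
proof -
  have MX: "subalgebra M HX" and MY: "subalgebra M HY" and MH: "subalgebra M H"
    using HXY HX HY H by (auto simp: subalgebra_def)
  define p where "p x = real_cond_exp M HX g x - real_cond_exp M H g x" for x
  define q where "q x = real_cond_exp M HY g x - real_cond_exp M H g x" for x
  define r where "r x = real_cond_exp M HXY g x - real_cond_exp M HY g x" for x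
  note c = cond_exp_sq_integrable[OF _ g]
  have p: "p \<in> sq_integrable M HX"
    unfolding p_def[abs_def] by (intro sq_integrable_diff MX c sq_integrable_mono[OF H(1)] MH)
  have q: "q \<in> sq_integrable M HY"
    unfolding q_def[abs_def] by (intro sq_integrable_diff MY c sq_integrable_mono[OF H(2)] MH)
  have r: "r \<in> sq_integrable M HXY"
    unfolding r_def[abs_def] by (intro sq_integrable_diff HXY c sq_integrable_mono[OF HY] MY)
  note pM = sq_integrable_mono[OF MX p] and qM = sq_integrable_mono[OF MY q]
    and rM = sq_integrable_mono[OF HXY r] and hM = sq_integrable_mono[OF MH c[OF MH]]
  have pp: "expectation (\<lambda>x. (p x)\<^sup>2) = V HX - V H"
    and qq: "expectation (\<lambda>x. (q x)\<^sup>2) = V HY - V H"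
    and rr: "expectation (\<lambda>x. (r x)\<^sup>2) = V HXY - V HY"
    unfolding V_def p_def q_def r_def
    by (rule expectation_cond_exp_sq_diff(1)[OF MX H(1) g] expectation_cond_exp_sq_diff(1)[OF MY H(2) g]
        expectation_cond_exp_sq_diff(1)[OF HXY HY g])+
  have sdp: "sd M p = sqrt (V HX - V H)"
    using pp cond_exp_increment_centered(2)[OF MX H(1) g] by (simp add: sd_def p_def[abs_def])
  have sdq: "sd M q = sqrt (V HY - V H)"
    using qq cond_exp_increment_centered(2)[OF MY H(2) g] by (simp add: sd_def q_def[abs_def])
  have ph: "expectation (\<lambda>x. p x * real_cond_exp M H g x) = 0"
  proof -
    have "expectation (\<lambda>x. p x * real_cond_exp M H g x)
      = expectation (\<lambda>x. real_cond_exp M H g x * real_cond_exp M HX g x - (real_cond_exp M H g x)\<^sup>2)"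
      by (simp add: p_def power2_eq_square algebra_simps)
    also have "\<dots> = 0"
      using expectation_cond_exp_sq_diff(2)[OF MX H(1) g] sq_integrableD(2)[OF hM]
        integrable_mult_sq_integrable[OF hM sq_integrable_mono[OF MX c[OF MX]]] by simp
    finally show ?thesis .
  qed
  \<comment> \<open>As \<open>p\<close> is \<open>HX\<close>-measurable and orthogonal to the
    projection of \<open>g\<close> on \<open>H\<close>, its squared norm is the inner product of
    \<open>p\<close> with the projection on \<open>HXY\<close>. That projection is the one on
    \<open>H\<close> plus \<open>q + r\<close>; the first part drops out, \<open>q\<close> is
    handled by the correlation bound and \<open>r\<close> by Cauchy-Schwarz.\<close>
  have "V HX - V H = expectation (\<lambda>x. p x * p x)"
    using pp by (simp add: power2_eq_square)
  also have "\<dots> = expectation (\<lambda>x. p x * real_cond_exp M HX g x - p x * real_cond_exp M H g x)"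
    by (subst (2) p_def) (simp add: algebra_simps)
  also have "\<dots> = expectation (\<lambda>x. p x * real_cond_exp M HX g x)"
    using ph integrable_mult_sq_integrable[OF pM hM]
      integrable_mult_sq_integrable[OF pM sq_integrable_mono[OF MX c[OF MX]]] by simp
  also have "\<dots> = expectation (\<lambda>x. p x * real_cond_exp M HXY g x)"
    using expectation_mult_cond_exp[OF MX p g]
      expectation_mult_cond_exp[OF HXY sq_integrable_mono[OF HX p] g] by simp
  also have "\<dots> = expectation (\<lambda>x. p x * r x + p x * q x + p x * real_cond_exp M H g x)"
    by (simp add: r_def q_def algebra_simps)
  also have "\<dots> = expectation (\<lambda>x. p x * r x) + expectation (\<lambda>x. p x * q x)"
    using ph integrable_mult_sq_integrable[OF pM hM] integrable_mult_sq_integrable[OF pM qM]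
      integrable_mult_sq_integrable[OF pM rM] by simp
  also have "\<dots> \<le> sqrt (V HX - V H) * sqrt (V HXY - V HY) + e * sqrt (V HX - V H) * sqrt (V HY - V H)"
  proof (rule add_mono)
    show "expectation (\<lambda>x. p x * r x) \<le> sqrt (V HX - V H) * sqrt (V HXY - V HY)"
      using Cauchy_Schwarz_expectation[OF pM rM] by (simp add: pp rr)
    have "\<bar>expectation (\<lambda>x. p x * q x)\<bar> \<le> e * sd M p * sd M q"
      using cond_exp_increment_centered(1)[OF MX H(1) g] cond_exp_increment_centered(1)[OF MY H(2) g]
      by (intro corr p q) (simp_all add: p_def[abs_def] q_def[abs_def])
    then show "expectation (\<lambda>x. p x * q x) \<le> e * sqrt (V HX - V H) * sqrt (V HY - V H)"
      by (simp add: sdp sdq)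
  qed
  finally have *: "V HX - V H \<le> sqrt (V HX - V H) * (sqrt (V HXY - V HY) + e * sqrt (V HY - V H))"
    by (simp add: algebra_simps)
  have nonneg: "0 \<le> V HX - V H" "0 \<le> V HXY - V HY" "0 \<le> V HY - V H"
    unfolding pp[symmetric] qq[symmetric] rr[symmetric] by simp_all
  show ?thesis
  proof (cases "V HX - V H = 0")
    case True
    then have "sqrt (V HX - V H) = 0" by simp
    then show ?thesis using nonneg e by simp
  next
    case False
    then have pos: "0 < sqrt (V HX - V H)" using nonneg by simp
    have "sqrt (V HX - V H) * sqrt (V HX - V H)
        \<le> sqrt (V HX - V H) * (sqrt (V HXY - V HY) + e * sqrt (V HY - V H))"
      using * nonneg(1) by simp
    then show ?thesis using pos by (rule mult_left_le_imp_le)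
  qed
qed

end

section \<open>Tensorization for finitely many variables\<close>

lemma space_join_alg [simp]: "space (join_alg M K F) = space M"
  by (simp add: join_alg_def space_measure_of_conv)

lemma sets_join_alg:
  assumes "\<And>k. k \<in> K \<Longrightarrow> sets (F k) \<subseteq> sets M"
  shows "sets (join_alg M K F) = sigma_sets (space M) (\<Union>k\<in>K. sets (F k))"
  unfolding join_alg_def
proof (rule sets_measure_of)
  show "(\<Union>k\<in>K. sets (F k)) \<subseteq> Pow (space M)"
    using assms sets.space_closed[of M] by blast
qed

lemma subalgebra_join_alg:
  assumes "\<And>k. k \<in> K \<Longrightarrow> sets (F k) \<subseteq> sets M"
  shows "subalgebra M (join_alg M K F)"
proof -
  have "sigma_sets (space M) (\<Union>k\<in>K. sets (F k)) \<subseteq> sets M"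
    using assms by (intro sets.sigma_sets_subset) blast
  then show ?thesis by (simp add: subalgebra_def sets_join_alg assms)
qed

lemma subalgebra_join_alg_mono:
  assumes F: "\<And>k. k \<in> K' \<Longrightarrow> sets (F k) \<subseteq> sets M" and K: "K \<subseteq> K'"
  shows "subalgebra (join_alg M K' F) (join_alg M K F)"
proof -
  have "sigma_sets (space M) (\<Union>k\<in>K. sets (F k)) \<subseteq> sigma_sets (space M) (\<Union>k\<in>K'. sets (F k))"
    using K by (intro sigma_sets_mono') blast
  moreover have "sets (join_alg M K F) = sigma_sets (space M) (\<Union>k\<in>K. sets (F k))"
    using F K by (intro sets_join_alg) blast
  moreover have "sets (join_alg M K' F) = sigma_sets (space M) (\<Union>k\<in>K'. sets (F k))"
    by (intro sets_join_alg F)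
  ultimately show ?thesis by (simp add: subalgebra_def)
qed

lemma subalgebra_join2_alg:
  assumes "sets F \<subseteq> sets M" "sets H \<subseteq> sets M"
  shows "subalgebra M (join2_alg M F H)" "sets F \<subseteq> sets (join2_alg M F H)"
    "sets H \<subseteq> sets (join2_alg M F H)"
proof -
  have *: "sets F \<union> sets H \<subseteq> Pow (space M)" using assms sets.space_closed[of M] by blast
  have "sigma_sets (space M) (sets F \<union> sets H) \<subseteq> sets M"
    using assms by (intro sets.sigma_sets_subset) blast
  with * show "subalgebra M (join2_alg M F H)"
    by (simp add: subalgebra_def join2_alg_def space_measure_of_conv)
  show "sets F \<subseteq> sets (join2_alg M F H)" "sets H \<subseteq> sets (join2_alg M F H)"
    using * by (auto simp: join2_alg_def)
qed

text \<open>Brings an increment obtained by revealing the variable \<open>k0\<close> into the domain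
  of the subjective correlation, which is phrased with \<open>join2_alg\<close>.\<close>

lemma subalgebra_join2_join_alg:
  assumes F: "\<And>k. k \<in> insert k0 K \<Longrightarrow> sets (F k) \<subseteq> sets M"
  shows "subalgebra (join2_alg M (F k0) (join_alg M K F)) (join_alg M (insert k0 K) F)"
proof -
  have H: "sets (join_alg M K F) \<subseteq> sets M"
    using subalgebra_join_alg[of K F M] F by (auto simp: subalgebra_def)
  note j2 = subalgebra_join2_alg[OF F[of k0] H]
  have sp: "space (join2_alg M (F k0) (join_alg M K F)) = space M"
    using j2(1) by (simp add: subalgebra_def)
  have "sets (F k) \<subseteq> sets (join2_alg M (F k0) (join_alg M K F))" if "k \<in> insert k0 K" for k
  proof (cases "k = k0")
    case False
    with that have "sets (F k) \<subseteq> sets (join_alg M K F)" using F by (auto simp: sets_join_alg)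
    then show ?thesis using j2(3) by blast
  qed (use j2(2) in simp)
  then have "sigma_sets (space (join2_alg M (F k0) (join_alg M K F))) (\<Union>k\<in>insert k0 K. sets (F k))
      \<subseteq> sets (join2_alg M (F k0) (join_alg M K F))"
    by (intro sets.sigma_sets_subset) blast
  moreover have "sets (join_alg M (insert k0 K) F) = sigma_sets (space M) (\<Union>k\<in>insert k0 K. sets (F k))"
    by (intro sets_join_alg F)
  ultimately show ?thesis by (simp add: subalgebra_def sp)
qed

context prob_space
begin

section \<open>Attainment of the subjective correlation\<close>

lemma sd_centered: "expectation f = 0 \<Longrightarrow> sd M f = sqrt (expectation (\<lambda>x. (f x)\<^sup>2))"
  by (simp add: sd_def)

lemma expectation_eq_0_cond_exp:
  assumes H: "subalgebra M H" and f: "integrable M f" and z: "AE x in M. real_cond_exp M H f x = 0"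
  shows "expectation f = 0"
proof -
  interpret H: sigma_finite_subalgebra M H by (rule sigma_finite_subalgebraI[OF H])
  have "expectation f = expectation (real_cond_exp M H f)" using H.real_cond_exp_int[OF f] by simp
  also have "\<dots> = expectation (\<lambda>_. 0)" using z by (intro integral_cong_AE) auto
  finally show ?thesis by simp
qed

text \<open>A \<open>LEAST\<close> over the reals is informative only if the minimum is attained.
  The constant 1 is admissible by Cauchy-Schwarz, because a function centred given \<open>H\<close>
  has mean 0; and each condition is a closed inequality in \<open>e\<close>, so the infimum is
  admissible too.\<close>

lemma subj_corr_props:
  assumes H: "subalgebra M H" and F: "sets F \<subseteq> sets M" and G: "sets G \<subseteq> sets M"
  shows "0 \<le> subj_corr M H F G" "subj_corr M H F G \<le> 1"
    and "\<And>f g. f \<in> sq_integrable M (join2_alg M F H) \<Longrightarrow> g \<in> sq_integrable M (join2_alg M G H) \<Longrightarrow>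
      AE x in M. real_cond_exp M H f x = 0 \<Longrightarrow> AE x in M. real_cond_exp M H g x = 0 \<Longrightarrow>
      \<bar>expectation (\<lambda>x. f x * g x)\<bar> \<le> subj_corr M H F G * sd M f * sd M g"
proof -
  define A where "A = {(f, g). f \<in> sq_integrable M (join2_alg M F H) \<and> g \<in> sq_integrable M (join2_alg M G H)
    \<and> (AE x in M. real_cond_exp M H f x = 0) \<and> (AE x in M. real_cond_exp M H g x = 0)}"
  define P where "P e \<longleftrightarrow> 0 \<le> e \<and> e \<le> 1 \<and>
    (\<forall>(f, g)\<in>A. \<bar>expectation (\<lambda>x. f x * g x)\<bar> \<le> e * sd M f * sd M g)" for e
  have HM: "sets H \<subseteq> sets M" using H by (simp add: subalgebra_def)
  have sd_nonneg: "0 \<le> sd M f" for f by (simp add: sd_def)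
  have cs: "\<bar>expectation (\<lambda>x. f x * g x)\<bar> \<le> sd M f * sd M g" if "(f, g) \<in> A" for f g
  proof -
    have f: "f \<in> sq_integrable M M" and g: "g \<in> sq_integrable M M"
      using that sq_integrable_mono subalgebra_join2_alg(1)[OF F HM] subalgebra_join2_alg(1)[OF G HM]
      by (auto simp: A_def)
    have "sd M f = sqrt (expectation (\<lambda>x. (f x)\<^sup>2))" "sd M g = sqrt (expectation (\<lambda>x. (g x)\<^sup>2))"
      using that f g by (auto simp: A_def intro!: sd_centered expectation_eq_0_cond_exp[OF H] sq_integrableD(3))
    then show ?thesis using Cauchy_Schwarz_expectation[OF f g] by simp
  qed
  have P1: "P 1" using cs by (auto simp: P_def)
  define m where "m = Inf {e. P e}"
  have bdd: "bdd_below {e. P e}" by (rule bdd_belowI[of _ 0]) (simp add: P_def)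
  have m0: "0 \<le> m" unfolding m_def using P1 by (intro cInf_greatest) (blast, simp add: P_def)
  have m_le: "m \<le> e" if "P e" for e unfolding m_def using that bdd by (intro cInf_lower) auto
  have "P m"
    unfolding P_def
  proof (intro conjI ballI, goal_cases)
    case (3 fg)
    obtain f g where fg: "fg = (f, g)" by (cases fg)
    show ?case
    \<comment> \<open>When a deviation vanishes there is no quotient to compare with
      \<open>e\<close>, but Cauchy-Schwarz already forces the expectation to be 0.\<close>
    proof (cases "sd M f * sd M g = 0")
      case True
      then have "m * sd M f * sd M g = 0" by auto
      then show ?thesis using cs[of f g] 3 True by (simp add: fg m0 sd_nonneg)
    next
      case False
      then have pos: "0 < sd M f * sd M g" using sd_nonneg[of f] sd_nonneg[of g] by (simp add: less_le)
      have "\<bar>expectation (\<lambda>x. f x * g x)\<bar> / (sd M f * sd M g) \<le> m"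
        unfolding m_def
      proof (rule cInf_greatest)
        fix e assume "e \<in> {e. P e}"
        then have "\<bar>expectation (\<lambda>x. f x * g x)\<bar> \<le> e * (sd M f * sd M g)"
          using 3 by (auto simp: P_def fg mult.assoc)
        then show "\<bar>expectation (\<lambda>x. f x * g x)\<bar> / (sd M f * sd M g) \<le> e"
          using pos by (simp add: pos_divide_le_eq)
      qed (use P1 in auto)
      then show ?thesis using pos by (simp add: pos_divide_le_eq fg mult.assoc)
    qed
  qed (use m0 m_le[OF P1] in auto)
  have "subj_corr M H F G = Least P"
    unfolding subj_corr_def P_def[abs_def] A_def by (rule arg_cong[where f = Least]) (auto simp: fun_eq_iff)
  also have "Least P = m" using \<open>P m\<close> m_le by (rule Least_equality)
  finally have "P (subj_corr M H F G)" using \<open>P m\<close> by simp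
  then show "0 \<le> subj_corr M H F G" "subj_corr M H F G \<le> 1"
    "\<And>f g. f \<in> sq_integrable M (join2_alg M F H) \<Longrightarrow> g \<in> sq_integrable M (join2_alg M G H) \<Longrightarrow>
      AE x in M. real_cond_exp M H f x = 0 \<Longrightarrow> AE x in M. real_cond_exp M H g x = 0 \<Longrightarrow>
      \<bar>expectation (\<lambda>x. f x * g x)\<bar> \<le> subj_corr M H F G * sd M f * sd M g"
    by (auto simp: P_def A_def)
qed

section \<open>Revealing the variables one at a time\<close>

lemma cond_exp_trivial:
  assumes "sets F = {{}, space M}" "space F = space M" "integrable M g"
  shows "AE x in M. real_cond_exp M F g x = expectation g"
proof -
  have F: "subalgebra M F" using assms by (simp add: subalgebra_def)
  interpret F: sigma_finite_subalgebra M F by (rule sigma_finite_subalgebraI[OF F])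
  show ?thesis
  proof (rule F.real_cond_exp_charact)
    fix A assume "A \<in> sets F"
    then consider "A = {}" | "A = space M" using assms by auto
    then show "(\<integral>x\<in>A. g x \<partial>M) = (\<integral>x\<in>A. expectation g \<partial>M)"
    proof cases
      case 2
      have "expectation (\<lambda>x. indicator (space M) x * h x) = expectation h" for h :: "'a \<Rightarrow> real"
        by (intro Bochner_Integration.integral_cong) auto
      then show ?thesis by (simp add: 2 set_lebesgue_integral_def prob_space)
    qed (simp add: set_lebesgue_integral_def)
  qed (use assms in auto)
qed

text \<open>Feeds \<open>corner_inequality\<close> into \<open>grid_bound\<close>. As
  \<open>f\<close> depends on the \<open>F\<close>-side only, \<open>g\<close> may be replaced by
  its projection on that side; Cauchy-Schwarz then leaves its energy \<open>V N 0\<close>, which the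
  grid bounds by \<open>s\<^sup>2\<close> times the energy of \<open>g\<close>.\<close>

lemma finite_tensorization:
  fixes F :: "'i \<Rightarrow> 'a measure" and G :: "'j \<Rightarrow> 'a measure"
  assumes fin: "finite I" "finite J"
    and F: "\<And>i. i \<in> I \<Longrightarrow> sets (F i) \<subseteq> sets M" and G: "\<And>j. j \<in> J \<Longrightarrow> sets (G j) \<subseteq> sets M"
    and e: "\<And>i j. i \<in> I \<Longrightarrow> j \<in> J \<Longrightarrow> 0 \<le> e i j"
    and corr: "\<And>i j K p q. i \<in> I \<Longrightarrow> j \<in> J \<Longrightarrow> K \<subseteq> I <+> J \<Longrightarrow>
      p \<in> sq_integrable M (join2_alg M (F i) (join_alg M K (case_sum F G))) \<Longrightarrow>
      q \<in> sq_integrable M (join2_alg M (G j) (join_alg M K (case_sum F G))) \<Longrightarrow>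
      AE x in M. real_cond_exp M (join_alg M K (case_sum F G)) p x = 0 \<Longrightarrow>
      AE x in M. real_cond_exp M (join_alg M K (case_sum F G)) q x = 0 \<Longrightarrow>
      \<bar>expectation (\<lambda>x. p x * q x)\<bar> \<le> e i j * sd M p * sd M q"
    and s: "0 < s" "s \<le> 1"
    and v: "\<And>j. j \<in> J \<Longrightarrow> 0 < v j"
    and u: "\<And>i. i \<in> I \<Longrightarrow> (\<Sum>j\<in>J. e i j * v j) < s * u i"
    and uv: "\<And>j. j \<in> J \<Longrightarrow> (\<Sum>i\<in>I. e i j * u i) \<le> s * v j"
    and f: "f \<in> sq_integrable M (join_alg M I F)"
    and g: "g \<in> sq_integrable M (join_alg M J G)" and g0: "expectation g = 0"
  shows "\<bar>expectation (\<lambda>x. f x * g x)\<bar>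
    \<le> s * sqrt (expectation (\<lambda>x. (f x)\<^sup>2)) * sqrt (expectation (\<lambda>x. (g x)\<^sup>2))"
proof -
  define N L where "N = card I" and "L = card J"
  obtain a b where a: "bij_betw a {..<N} I" and b: "bij_betw b {..<L} J"
    using ex_bij_betw_nat_finite[OF fin(1)] ex_bij_betw_nat_finite[OF fin(2)]
    by (auto simp: N_def L_def lessThan_atLeast0)
  have aI: "a ` {..<N} = I" and bJ: "b ` {..<L} = J" using a b by (auto simp: bij_betw_def)
  have a_in: "a i \<in> I" if "i < N" for i using that aI by blast
  have b_in: "b j \<in> J" if "j < L" for j using that bJ by blast
  define Z where "Z = case_sum F G"
  \<comment> \<open>The intersections cap the indices at \<open>N\<close> and \<open>L\<close>, so
    that the algebras increase for all natural numbers, as the monotonicity hypotheses of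
    \<open>grid_bound\<close> require.\<close>
  define K where "K i j = Inl ` a ` ({..<i} \<inter> {..<N}) \<union> Inr ` b ` ({..<j} \<inter> {..<L})" for i j
  have K_sub: "K i j \<subseteq> I <+> J" for i j using aI bJ unfolding K_def by auto
  have Z_sub: "sets (Z k) \<subseteq> sets M" if "k \<in> I <+> J" for k
    using that by (auto simp: Z_def dest: F[THEN subsetD] G[THEN subsetD])
  have ZK: "sets (Z k) \<subseteq> sets M" if "k \<in> K i j" for k i j using that Z_sub K_sub by blast
  define A where "A i j = join_alg M (K i j) Z" for i j
  have A_M: "subalgebra M (A i j)" for i j
    unfolding A_def by (intro subalgebra_join_alg ZK)
  have A_mono: "subalgebra (A i' j') (A i j)" if "i \<le> i'" "j \<le> j'" for i j i' j'
    unfolding A_def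
  proof (rule subalgebra_join_alg_mono)
    show "K i j \<subseteq> K i' j'" unfolding K_def using that by (intro Un_mono image_mono) auto
  qed (rule ZK)
  have gM: "g \<in> sq_integrable M M"
    using g sq_integrable_mono[OF subalgebra_join_alg] G by blast
  have fM: "f \<in> sq_integrable M M"
    using f sq_integrable_mono[OF subalgebra_join_alg] F by blast
  define V where "V i j = expectation (\<lambda>x. (real_cond_exp M (A i j) g x)\<^sup>2)" for i j
  have V_mono: "V i j \<le> V i' j'" if "i \<le> i'" "j \<le> j'" for i j i' j'
  proof -
    have "0 \<le> expectation (\<lambda>x. (real_cond_exp M (A i' j') g x - real_cond_exp M (A i j) g x)\<^sup>2)" by simp
    also have "\<dots> = V i' j' - V i j"
      unfolding V_def by (rule expectation_cond_exp_sq_diff(1)[OF A_M A_mono[OF that] gM])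
    finally show ?thesis by simp
  qed
  have gA: "g \<in> sq_integrable M (A i L)" for i
  proof -
    have "subalgebra (A i L) (join_alg M J G)"
    proof -
      have "subalgebra (A i L) (join_alg M (Inr ` J) Z)"
        unfolding A_def 
      proof (rule subalgebra_join_alg_mono)
        show "Inr ` J \<subseteq> K i L" by (simp add: K_def bJ)
      qed (rule ZK)
      moreover have "join_alg M (Inr ` J) Z = join_alg M J G" by (simp add: join_alg_def Z_def)
      ultimately show ?thesis by simp
    qed
    then show ?thesis using g by (rule sq_integrable_mono)
  qed
  \<comment> \<open>In column \<open>L\<close> the whole \<open>G\<close>-side is revealed, so
    \<open>g\<close> is known there in every row and no energy remains.\<close>
  have last: "V i L = expectation (\<lambda>x. (g x)\<^sup>2)" for i
  proof -
    interpret A: sigma_finite_subalgebra M "A i L" by (rule sigma_finite_subalgebraI[OF A_M])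
    have "AE x in M. real_cond_exp M (A i L) g x = g x"
      using gA[of i] sq_integrableD(3)[OF gM] by (intro A.real_cond_exp_F_meas) (simp_all add: sq_integrable_def)
    then have "AE x in M. (real_cond_exp M (A i L) g x)\<^sup>2 = (g x)\<^sup>2" by eventually_elim simp
    then show ?thesis
      unfolding V_def using sq_integrableD(1)[OF gM] by (intro integral_cong_AE) auto
  qed
  have first: "V 0 0 = 0"
  proof -
    have "AE x in M. real_cond_exp M (A 0 0) g x = expectation g"
    proof (rule cond_exp_trivial[OF _ _ sq_integrableD(3)[OF gM]])
      show "sets (A 0 0) = {{}, space M}"
        using sets_join_alg[of "{}" Z M] by (simp add: A_def K_def sigma_sets_empty_eq)
    qed (simp add: A_def)
    then have "AE x in M. (real_cond_exp M (A 0 0) g x)\<^sup>2 = 0" by eventually_elim (simp add: g0)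
    then have "V 0 0 = expectation (\<lambda>_. 0)" unfolding V_def by (intro integral_cong_AE) auto
    then show ?thesis by simp
  qed
  have corner: "sqrt (V (Suc i) j - V i j)
      \<le> sqrt (V (Suc i) (Suc j) - V i (Suc j)) + e (a i) (b j) * sqrt (V i (Suc j) - V i j)"
    if ij: "i < N" "j < L" for i j
    unfolding V_def
  proof (rule corner_inequality[OF A_M A_mono A_mono A_mono A_mono gM e[OF a_in[OF ij(1)] b_in[OF ij(2)]]])
    fix p q assume p: "p \<in> sq_integrable M (A (Suc i) j)" and q: "q \<in> sq_integrable M (A i (Suc j))"
      and z: "AE x in M. real_cond_exp M (A i j) p x = 0" "AE x in M. real_cond_exp M (A i j) q x = 0"
    have K1: "K (Suc i) j = insert (Inl (a i)) (K i j)" and K2: "K i (Suc j) = insert (Inr (b j)) (K i j)"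
      using ij by (auto simp: K_def lessThan_Suc)
    have "subalgebra (join2_alg M (Z (Inl (a i))) (A i j)) (A (Suc i) j)"
      unfolding A_def K1 by (rule subalgebra_join2_join_alg) (use ZK K1 in blast)
    then have p': "p \<in> sq_integrable M (join2_alg M (F (a i)) (A i j))"
      using p sq_integrable_mono by (simp add: Z_def)
    have "subalgebra (join2_alg M (Z (Inr (b j))) (A i j)) (A i (Suc j))"
      unfolding A_def K2 by (rule subalgebra_join2_join_alg) (use ZK K2 in blast)
    then have q': "q \<in> sq_integrable M (join2_alg M (G (b j)) (A i j))"
      using q sq_integrable_mono by (simp add: Z_def)
    show "\<bar>expectation (\<lambda>x. p x * q x)\<bar> \<le> e (a i) (b j) * sd M p * sd M q"
      using corr[OF a_in[OF ij(1)] b_in[OF ij(2)] K_sub, of p i j q] p' q' z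
      unfolding A_def Z_def by blast
  qed simp_all
  have "V N 0 - V 0 0 \<le> s\<^sup>2 * (V 0 L - V 0 0)"
  proof (rule grid_bound[where e = "\<lambda>i j. e (a i) (b j)" and u = "\<lambda>i. u (a i)" and v = "\<lambda>j. v (b j)"])
    fix i assume "i < N"
    then show "(\<Sum>j<L. e (a i) (b j) * v (b j)) < s * u (a i)"
      using u[OF a_in] sum.reindex_bij_betw[OF b, of "\<lambda>j. e (a i) j * v j"] by simp
  next
    fix j assume "j < L"
    then show "(\<Sum>i<N. e (a i) (b j) * u (a i)) \<le> s * v (b j)"
      using uv[OF b_in] sum.reindex_bij_betw[OF a, of "\<lambda>i. e i (b j) * u i"] by simp
  qed (use V_mono last corner e a_in b_in v s in auto)
  then have VN: "V N 0 \<le> s\<^sup>2 * expectation (\<lambda>x. (g x)\<^sup>2)" by (simp add: first last)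
  have fA: "f \<in> sq_integrable M (A N 0)"
  proof -
    have "A N 0 = join_alg M I F"
      by (simp add: A_def K_def aI join_alg_def Z_def)
    then show ?thesis using f by simp
  qed
  \<comment> \<open>\<open>A N 0\<close> is the join of the whole \<open>F\<close>-side with nothing
    from the \<open>G\<close>-side, so \<open>f\<close> is measurable for it.\<close>
  have "\<bar>expectation (\<lambda>x. f x * g x)\<bar> = \<bar>expectation (\<lambda>x. f x * real_cond_exp M (A N 0) g x)\<bar>"
    using expectation_mult_cond_exp[OF A_M fA gM] by simp
  also have "\<dots> \<le> sqrt (expectation (\<lambda>x. (f x)\<^sup>2)) * sqrt (V N 0)"
    unfolding V_def
    by (rule Cauchy_Schwarz_expectation[OF fM sq_integrable_mono[OF A_M cond_exp_sq_integrable[OF A_M gM]]])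
  also have "\<dots> \<le> sqrt (expectation (\<lambda>x. (f x)\<^sup>2)) * sqrt (s\<^sup>2 * expectation (\<lambda>x. (g x)\<^sup>2))"
    using VN by (intro mult_left_mono) auto
  also have "\<dots> = s * sqrt (expectation (\<lambda>x. (f x)\<^sup>2)) * sqrt (expectation (\<lambda>x. (g x)\<^sup>2))"
    using s by (simp add: real_sqrt_mult)
  finally show ?thesis .
qed

end

section \<open>Approximation by finitely many variables\<close>

context prob_space
begin

section \<open>Closure properties of the approximable functions\<close>

lemma expectation_sq_diff_triangle:
  assumes "f \<in> sq_integrable M M" "g \<in> sq_integrable M M" "h \<in> sq_integrable M M"
  shows "expectation (\<lambda>x. (f x - h x)\<^sup>2)
    \<le> 2 * expectation (\<lambda>x. (f x - g x)\<^sup>2) + 2 * expectation (\<lambda>x. (g x - h x)\<^sup>2)"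
proof -
  have fg: "integrable M (\<lambda>x. (f x - g x)\<^sup>2)" and gh: "integrable M (\<lambda>x. (g x - h x)\<^sup>2)"
    and fh: "integrable M (\<lambda>x. (f x - h x)\<^sup>2)"
    by (intro sq_integrableD sq_integrable_diff subalgebra_self assms)+
  have "(a - c)\<^sup>2 \<le> 2 * (a - b)\<^sup>2 + 2 * (b - c)\<^sup>2" for a b c :: real
    using zero_le_power2[of "(a - b) - (b - c)"] by (simp add: power2_eq_square algebra_simps)
  then have "expectation (\<lambda>x. (f x - h x)\<^sup>2)
      \<le> expectation (\<lambda>x. 2 * (f x - g x)\<^sup>2 + 2 * (g x - h x)\<^sup>2)"
    by (intro integral_mono fh Bochner_Integration.integrable_add integrable_mult_right fg gh)
  then show ?thesis using fg gh by simp
qed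

definition L2_approximable :: "'i set \<Rightarrow> ('i \<Rightarrow> 'a measure) \<Rightarrow> ('a \<Rightarrow> real) \<Rightarrow> bool" where
  "L2_approximable I F f \<longleftrightarrow> f \<in> sq_integrable M M \<and>
    (\<forall>d>0. \<exists>I0 h. finite I0 \<and> I0 \<subseteq> I \<and> h \<in> sq_integrable M (join_alg M I0 F) \<and>
      expectation (\<lambda>x. (f x - h x)\<^sup>2) < d)"

lemma L2_approximableE:
  assumes "L2_approximable I F f" "0 < d"
  obtains I0 h where "finite I0" "I0 \<subseteq> I" "h \<in> sq_integrable M (join_alg M I0 F)"
    "expectation (\<lambda>x. (f x - h x)\<^sup>2) < d"
  using assms unfolding L2_approximable_def by blast

context
  fixes I :: "'i set" and F :: "'i \<Rightarrow> 'a measure"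
  assumes F: "\<And>i. i \<in> I \<Longrightarrow> sets (F i) \<subseteq> sets M"
begin

lemma subalgebra_join_alg_subset: "I0 \<subseteq> I \<Longrightarrow> subalgebra M (join_alg M I0 F)"
  using F by (intro subalgebra_join_alg) blast

lemma L2_approximable_finite:
  assumes "finite I0" "I0 \<subseteq> I" "h \<in> sq_integrable M (join_alg M I0 F)"
  shows "L2_approximable I F h"
proof -
  have "expectation (\<lambda>x. (h x - h x)\<^sup>2) < d" if "0 < d" for d using that by simp
  moreover have "h \<in> sq_integrable M M"
    by (rule sq_integrable_mono[OF subalgebra_join_alg_subset]) (use assms in auto)
  ultimately show ?thesis unfolding L2_approximable_def using assms by blast
qed

lemma L2_approximable_limit:
  assumes f: "f \<in> sq_integrable M M" and s: "\<And>n. L2_approximable I F (s n)"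
    and lim: "(\<lambda>n. expectation (\<lambda>x. (f x - s n x)\<^sup>2)) \<longlonglongrightarrow> 0"
  shows "L2_approximable I F f"
  unfolding L2_approximable_def
proof (intro conjI f allI impI)
  fix d :: real assume d: "0 < d"
  \<comment> \<open>The quarter compensates for the factor 2 on each of the two terms of
    \<open>expectation_sq_diff_triangle\<close>.\<close>
  then have "eventually (\<lambda>n. expectation (\<lambda>x. (f x - s n x)\<^sup>2) < d / 4) sequentially"
    by (intro order_tendstoD[OF lim]) simp
  then obtain n where n: "expectation (\<lambda>x. (f x - s n x)\<^sup>2) < d / 4"
    using eventually_happens'[OF sequentially_bot] by blast
  obtain I0 h where I0: "finite I0" "I0 \<subseteq> I" and h: "h \<in> sq_integrable M (join_alg M I0 F)"
    and e: "expectation (\<lambda>x. (s n x - h x)\<^sup>2) < d / 4"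
    using L2_approximableE[OF s[of n], of "d / 4"] d by auto
  have "s n \<in> sq_integrable M M" using s[of n] by (simp add: L2_approximable_def)
  then have "expectation (\<lambda>x. (f x - h x)\<^sup>2) < d"
    using expectation_sq_diff_triangle[OF f _ sq_integrable_mono[OF subalgebra_join_alg_subset[OF I0(2)] h], of "s n"]
      n e by simp
  then show "\<exists>I0 h. finite I0 \<and> I0 \<subseteq> I \<and> h \<in> sq_integrable M (join_alg M I0 F) \<and>
      expectation (\<lambda>x. (f x - h x)\<^sup>2) < d" using I0 h by blast
qed

text \<open>A constant sequence in \<open>L2_approximable_limit\<close>. It serves for
  representations that hold on \<open>space M\<close> only, such as that of the indicator of a
  complement.\<close>

lemma L2_approximable_cong:
  assumes f: "L2_approximable I F f" and g: "g \<in> sq_integrable M M"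
    and eq: "\<And>x. x \<in> space M \<Longrightarrow> f x = g x"
  shows "L2_approximable I F g"
proof (rule L2_approximable_limit[OF g f])
  have "expectation (\<lambda>x. (g x - f x)\<^sup>2) = expectation (\<lambda>x. 0)"
    using eq by (intro Bochner_Integration.integral_cong) auto
  then show "(\<lambda>n. expectation (\<lambda>x. (g x - f x)\<^sup>2)) \<longlonglongrightarrow> 0" by simp
qed

lemma L2_approximable_add:
  assumes f: "L2_approximable I F f" and g: "L2_approximable I F g"
  shows "L2_approximable I F (\<lambda>x. f x + g x)"
proof -
  have fM: "f \<in> sq_integrable M M" and gM: "g \<in> sq_integrable M M"
    using f g by (simp_all add: L2_approximable_def)
  show ?thesis
    unfolding L2_approximable_def
  proof (intro conjI allI impI)
    show fgM: "(\<lambda>x. f x + g x) \<in> sq_integrable M M"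
      by (intro sq_integrable_add subalgebra_self fM gM)
    fix d :: real assume d: "0 < d"
    obtain I1 h where I1: "finite I1" "I1 \<subseteq> I" and h: "h \<in> sq_integrable M (join_alg M I1 F)"
      and e1: "expectation (\<lambda>x. (f x - h x)\<^sup>2) < d / 4"
      using L2_approximableE[OF f, of "d / 4"] d by auto
    obtain I2 k where I2: "finite I2" "I2 \<subseteq> I" and k: "k \<in> sq_integrable M (join_alg M I2 F)"
      and e2: "expectation (\<lambda>x. (g x - k x)\<^sup>2) < d / 4"
      using L2_approximableE[OF g, of "d / 4"] d by auto
    have U: "I1 \<union> I2 \<subseteq> I" using I1 I2 by simp
    note UM = subalgebra_join_alg_subset[OF U]
    have hU: "h \<in> sq_integrable M (join_alg M (I1 \<union> I2) F)"
      by (rule sq_integrable_mono[OF subalgebra_join_alg_mono h]) (use U F in auto)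
    have kU: "k \<in> sq_integrable M (join_alg M (I1 \<union> I2) F)"
      by (rule sq_integrable_mono[OF subalgebra_join_alg_mono k]) (use U F in auto)
    note hM = sq_integrable_mono[OF UM hU] and kM = sq_integrable_mono[OF UM kU]
    have hk: "(\<lambda>x. h x + k x) \<in> sq_integrable M (join_alg M (I1 \<union> I2) F)"
      by (intro sq_integrable_add UM hU kU)
    have "(\<lambda>x. h x + g x) \<in> sq_integrable M M"
      by (intro sq_integrable_add subalgebra_self hM gM)
    from expectation_sq_diff_triangle[OF fgM this sq_integrable_mono[OF UM hk]]
    have "expectation (\<lambda>x. (f x + g x - (h x + k x))\<^sup>2) < d" using e1 e2 by (simp add: algebra_simps)
    then show "\<exists>I0 h. finite I0 \<and> I0 \<subseteq> I \<and> h \<in> sq_integrable M (join_alg M I0 F) \<and>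
      expectation (\<lambda>x. (f x + g x - h x)\<^sup>2) < d" using hk U I1 I2 by blast
  qed
qed

lemma L2_approximable_cmult:
  assumes f: "L2_approximable I F f"
  shows "L2_approximable I F (\<lambda>x. c * f x)"
proof -
  have fM: "f \<in> sq_integrable M M" using f by (simp add: L2_approximable_def)
  show ?thesis
    unfolding L2_approximable_def
  proof (intro conjI allI impI)
    show "(\<lambda>x. c * f x) \<in> sq_integrable M M" by (intro sq_integrable_cmult fM)
    fix d :: real assume d: "0 < d"
    \<comment> \<open>Adding 1 avoids a division by 0 when \<open>c = 0\<close>.\<close>
    have c: "0 < c\<^sup>2 + 1" by (simp add: add_nonneg_pos)
    then obtain I0 h where I0: "finite I0" "I0 \<subseteq> I" and h: "h \<in> sq_integrable M (join_alg M I0 F)"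
      and e: "expectation (\<lambda>x. (f x - h x)\<^sup>2) < d / (c\<^sup>2 + 1)"
      using L2_approximableE[OF f, of "d / (c\<^sup>2 + 1)"] d by auto
    have "expectation (\<lambda>x. (c * f x - c * h x)\<^sup>2) = c\<^sup>2 * expectation (\<lambda>x. (f x - h x)\<^sup>2)"
      by (simp add: power_mult_distrib flip: right_diff_distrib)
    also have "\<dots> \<le> (c\<^sup>2 + 1) * expectation (\<lambda>x. (f x - h x)\<^sup>2)" by (intro mult_right_mono) simp_all
    also have "\<dots> < d" using e c by (simp add: pos_less_divide_eq mult.commute)
    finally show "\<exists>I0 h. finite I0 \<and> I0 \<subseteq> I \<and> h \<in> sq_integrable M (join_alg M I0 F) \<and>
      expectation (\<lambda>x. (c * f x - h x)\<^sup>2) < d"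
      using I0 sq_integrable_cmult[OF h, of c] by blast
  qed
qed

lemma L2_approximable_const: "L2_approximable I F (\<lambda>x. c)"
  by (rule L2_approximable_finite[of "{}"]) (simp_all add: sq_integrable_const)

lemma L2_approximable_sum:
  assumes "\<And>a. a \<in> A \<Longrightarrow> L2_approximable I F (s a)"
  shows "L2_approximable I F (\<lambda>x. \<Sum>a\<in>A. s a x)"
  using assms
proof (induction A rule: infinite_finite_induct)
  case (insert a A)
  then show ?case by (simp add: L2_approximable_add)
qed (simp_all add: L2_approximable_const)

section \<open>From indicators to all square-integrable functions\<close>

text \<open>A Dynkin argument. Events that depend on finitely many variables form an
  intersection-stable generator, since two finite index sets can be united; approximability passes
  to complements by linearity and to disjoint unions by dominated convergence.\<close>

lemma L2_approximable_indicator: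
  assumes "A \<in> sets (join_alg M I F)"
  shows "L2_approximable I F (indicator A)"
proof -
  define E where "E = (\<Union>I0\<in>{I0. finite I0 \<and> I0 \<subseteq> I}. sets (join_alg M I0 F))"
  have E: "\<exists>I0. finite I0 \<and> I0 \<subseteq> I \<and> A \<in> sets (join_alg M I0 F)" if "A \<in> E" for A
    using that by (auto simp: E_def)
  have E_M: "E \<subseteq> sets M"
    using subalgebra_join_alg_subset by (auto simp: E_def subalgebra_def)
  have "Int_stable E"
  proof (rule Int_stableI)
    fix A B assume "A \<in> E" "B \<in> E"
    then obtain I1 I2 where I: "finite I1" "I1 \<subseteq> I" "finite I2" "I2 \<subseteq> I"
      and AB: "A \<in> sets (join_alg M I1 F)" "B \<in> sets (join_alg M I2 F)" using E by meson
    have "subalgebra (join_alg M (I1 \<union> I2) F) (join_alg M I1 F)"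
      "subalgebra (join_alg M (I1 \<union> I2) F) (join_alg M I2 F)"
      using I F by (auto intro!: subalgebra_join_alg_mono)
    then have "A \<inter> B \<in> sets (join_alg M (I1 \<union> I2) F)" using AB by (auto simp: subalgebra_def)
    then show "A \<inter> B \<in> E" using I by (auto simp: E_def)
  qed
  moreover have E_Pow: "E \<subseteq> Pow (space M)" using E_M sets.space_closed[of M] by blast
  moreover have "A \<in> sigma_sets (space M) E"
  proof -
    have "sets (F i) \<subseteq> E" if "i \<in> I" for i
    proof -
      have "sets (join_alg M {i} F) = sigma_sets (space M) (\<Union>k\<in>{i}. sets (F k))"
        using that F by (intro sets_join_alg) auto
      then have "sets (F i) \<subseteq> sets (join_alg M {i} F)" by auto
      moreover have "sets (join_alg M {i} F) \<subseteq> E"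
        unfolding E_def using that by (intro UN_upper) simp
      ultimately show ?thesis by blast
    qed
    then have "sigma_sets (space M) (\<Union>i\<in>I. sets (F i)) \<subseteq> sigma_sets (space M) E"
      by (intro sigma_sets_mono') blast
    then show ?thesis using assms sets_join_alg[of I F M] F by auto
  qed
  ultimately show ?thesis
  proof (induction rule: sigma_sets_induct_disjoint)
    case (basic A)
    then obtain I0 where I0: "finite I0" "I0 \<subseteq> I" "A \<in> sets (join_alg M I0 F)" using E by blast
    show ?case
      by (rule L2_approximable_finite[OF I0(1,2) sq_integrable_indicator[OF subalgebra_join_alg_subset[OF I0(2)] I0(3)]])
  next
    case empty
    show ?case using L2_approximable_const[of 0] by (simp add: indicator_def[abs_def])
  next
    case (compl A)
    have A: "A \<in> sets M" using compl.hyps E_M sets.sigma_sets_subset by blast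
    have "L2_approximable I F (\<lambda>x. 1 + (- 1) * indicator A x)"
      by (intro L2_approximable_add L2_approximable_const L2_approximable_cmult compl.IH)
    then show ?case
    proof (rule L2_approximable_cong)
      show "indicator (space M - A) \<in> sq_integrable M M"
        using A by (intro sq_integrable_indicator subalgebra_self) auto
    qed (simp add: indicator_def)
  next
    case (union A)
    have A: "A n \<in> sets M" for n using union.hyps E_M sets.sigma_sets_subset by blast
    have eq: "indicator (\<Union>i<n. A i) x = (\<Sum>i<n. indicator (A i) x :: real)" for n x
      using union.hyps(1) by (intro indicator_UN_disjoint) (auto simp: disjoint_family_on_def)
    show ?case
    proof (rule L2_approximable_limit)
      show "indicator (\<Union>(range A)) \<in> sq_integrable M M"
        using A by (intro sq_integrable_indicator subalgebra_self) auto
      show "L2_approximable I F (\<lambda>x. \<Sum>i<n. indicator (A i) x)" for n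
        by (intro L2_approximable_sum union.IH)
      have "(\<lambda>n. expectation (\<lambda>x. (indicator (\<Union>(range A)) x - indicator (\<Union>i<n. A i) x :: real)\<^sup>2))
          \<longlonglongrightarrow> expectation (\<lambda>x. 0)"
      proof (rule integral_dominated_convergence[where w = "\<lambda>_. 1"])
        show "AE x in M. (\<lambda>n. (indicator (\<Union>(range A)) x - indicator (\<Union>i<n. A i) x)\<^sup>2) \<longlonglongrightarrow> (0::real)"
        proof (intro AE_I2)
          fix x
          have "(\<lambda>n. (indicator (\<Union>(range A)) x - indicator (\<Union>i<n. A i) x)\<^sup>2)
            \<longlonglongrightarrow> (indicator (\<Union>(range A)) x - indicator (\<Union>(range A)) x :: real)\<^sup>2"
            by (intro tendsto_intros LIMSEQ_indicator_UN)
          then show "(\<lambda>n. (indicator (\<Union>(range A)) x - indicator (\<Union>i<n. A i) x)\<^sup>2) \<longlonglongrightarrow> (0::real)"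
            by simp
        qed
      qed (use A in \<open>auto simp: indicator_def\<close>)
      then show "(\<lambda>n. expectation (\<lambda>x. (indicator (\<Union>(range A)) x - (\<Sum>i<n. indicator (A i) x) :: real)\<^sup>2)) \<longlonglongrightarrow> 0"
        by (simp add: eq)
    qed
  qed
qed

lemma L2_approximable_all:
  assumes f: "f \<in> sq_integrable M (join_alg M I F)"
  shows "L2_approximable I F f"
proof -
  let ?G = "join_alg M I F"
  have G: "subalgebra M ?G" by (rule subalgebra_join_alg_subset) simp
  have fM: "f \<in> sq_integrable M M" by (rule sq_integrable_mono[OF G f])
  have "f \<in> borel_measurable ?G" using f by (simp add: sq_integrable_def)
  \<comment> \<open>Centring the approximation at 0 makes every simple function at most
    \<open>2 * \<bar>f x\<bar>\<close> in absolute value, hence square-integrable.\<close>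
  from borel_measurable_implies_sequence_metric[OF this, of 0]
  obtain s where s: "\<And>n. simple_function ?G (s n)"
    and lim: "\<And>x. x \<in> space M \<Longrightarrow> (\<lambda>n. s n x) \<longlonglongrightarrow> f x"
    and bnd: "\<And>n x. x \<in> space M \<Longrightarrow> \<bar>s n x\<bar> \<le> 2 * \<bar>f x\<bar>"
    by (simp add: dist_real_def) metis
  have s_meas: "s n \<in> borel_measurable M" for n
    using measurable_from_subalg[OF G borel_measurable_simple_function[OF s]] .
  have f_meas: "f \<in> borel_measurable M" using fM by (rule sq_integrableD)
  have sM: "s n \<in> sq_integrable M M" for n
  proof -
    have "integrable M (\<lambda>x. (s n x)\<^sup>2)"
    proof (rule Bochner_Integration.integrable_bound)
      show "integrable M (\<lambda>x. 4 * (f x)\<^sup>2)" by (intro integrable_mult_right sq_integrableD fM)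
      show "(\<lambda>x. (s n x)\<^sup>2) \<in> borel_measurable M" using s_meas by measurable
      have "(s n x)\<^sup>2 \<le> 4 * (f x)\<^sup>2" if "x \<in> space M" for x
        using power_mono[OF bnd[OF that, of n], of 2] by (simp add: power_mult_distrib)
      then show "AE x in M. norm ((s n x)\<^sup>2) \<le> norm (4 * (f x)\<^sup>2)" by (intro AE_I2) simp
    qed
    with s_meas show ?thesis by (simp add: sq_integrable_def)
  qed
  show ?thesis
  proof (rule L2_approximable_limit[OF fM])
    fix n
    have "L2_approximable I F (\<lambda>x. \<Sum>y\<in>s n ` space ?G. y * indicator (s n -` {y} \<inter> space ?G) x)"
      using s by (intro L2_approximable_sum L2_approximable_cmult L2_approximable_indicator simple_functionD)
    then show "L2_approximable I F (s n)"
    proof (rule L2_approximable_cong[OF _ sM])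
      fix x assume "x \<in> space M"
      then show "(\<Sum>y\<in>s n ` space ?G. y * indicator (s n -` {y} \<inter> space ?G) x) = s n x"
        using simple_functionD(1)[OF s[of n]]
        by (subst sum.remove[of _ "s n x"]) (auto intro!: sum.neutral simp: indicator_def)
    qed
  next
    have "(\<lambda>n. expectation (\<lambda>x. (f x - s n x)\<^sup>2)) \<longlonglongrightarrow> expectation (\<lambda>x. 0)"
    \<comment> \<open>The constant is \<open>(1 + 2)\<^sup>2\<close>, from the bound
      \<open>\<bar>s n x\<bar> \<le> 2 * \<bar>f x\<bar>\<close>.\<close>
    proof (rule integral_dominated_convergence[where w = "\<lambda>x. 9 * (f x)\<^sup>2"])
      show "AE x in M. (\<lambda>n. (f x - s n x)\<^sup>2) \<longlonglongrightarrow> 0"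
      proof (intro AE_I2)
        fix x assume "x \<in> space M"
        from lim[OF this] have "(\<lambda>n. (f x - s n x)\<^sup>2) \<longlonglongrightarrow> (f x - f x)\<^sup>2" by (intro tendsto_intros)
        then show "(\<lambda>n. (f x - s n x)\<^sup>2) \<longlonglongrightarrow> 0" by simp
      qed
      show "integrable M (\<lambda>x. 9 * (f x)\<^sup>2)" by (intro integrable_mult_right sq_integrableD fM)
      fix n
      show "(\<lambda>x. (f x - s n x)\<^sup>2) \<in> borel_measurable M" using s_meas f_meas by measurable
      show "AE x in M. norm ((f x - s n x)\<^sup>2) \<le> 9 * (f x)\<^sup>2"
      proof (intro AE_I2)
        fix x assume "x \<in> space M"
        from bnd[OF this, of n] have "\<bar>f x - s n x\<bar> \<le> 3 * \<bar>f x\<bar>" by linarith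
        from power_mono[OF this, of 2] show "norm ((f x - s n x)\<^sup>2) \<le> 9 * (f x)\<^sup>2"
          by (simp add: power_mult_distrib)
      qed
    qed simp
    then show "(\<lambda>n. expectation (\<lambda>x. (f x - s n x)\<^sup>2)) \<longlonglongrightarrow> 0" by simp
  qed
qed

end
end

section \<open>Tensorization in general\<close>

lemma mat_onorm_nonneg: "0 \<le> mat_onorm I J e"
proof -
  have "0 \<le> (SUP a\<in>{a\<in>l2 J. l2_norm J a \<le> 1}. ereal (l2_norm I (mat_op J e a)))"
    by (rule SUP_upper2[of "\<lambda>_. 0"]) (simp_all add: l2_def l2_norm_def infsum_nonneg)
  then show ?thesis by (simp add: mat_onorm_def)
qed

text \<open>A submatrix has no larger norm: extend the normalized vector by 0 outside
  \<open>J0\<close>, apply the full operator, and restrict the image to \<open>I0\<close>.\<close>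

lemma mat_onorm_finite_section:
  assumes S: "mat_onorm I J e = ereal S" and fin: "finite I0" "I0 \<subseteq> I" "finite J0" "J0 \<subseteq> J"
  shows "L2_set (\<lambda>i. \<Sum>j\<in>J0. e i j * a j) I0 \<le> S * L2_set a J0"
proof (cases "L2_set a J0 = 0")
  case True
  then have "\<forall>j\<in>J0. a j = 0" using fin by (simp add: L2_set_eq_0_iff)
  then show ?thesis by (simp add: True L2_set_0')
next
  case False
  define r where "r = L2_set a J0"
  have r: "0 < r" using False by (simp add: r_def less_le)
  define b where "b j = (if j \<in> J0 then a j / r else 0)" for j
  have op: "mat_op J e b i = (\<Sum>j\<in>J0. e i j * a j) / r" for i
  proof -
    have "mat_op J e b i = (\<Sum>\<^sub>\<infinity>j\<in>J0. e i j * b j)"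
      unfolding mat_op_def using fin by (intro infsum_cong_neutral) (auto simp: b_def)
    also have "\<dots> = (\<Sum>j\<in>J0. e i j * a j) / r"
      using fin by (simp add: b_def sum_divide_distrib)
    finally show ?thesis .
  qed
  have "(\<lambda>j. (b j)\<^sup>2) summable_on J \<longleftrightarrow> (\<lambda>j. (b j)\<^sup>2) summable_on J0"
    using fin by (intro summable_on_cong_neutral) (auto simp: b_def)
  then have b_l2: "b \<in> l2 J" using fin by (simp add: l2_def)
  have "(\<Sum>\<^sub>\<infinity>j\<in>J. (b j)\<^sup>2) = (\<Sum>\<^sub>\<infinity>j\<in>J0. (b j)\<^sup>2)"
    using fin by (intro infsum_cong_neutral) (auto simp: b_def)
  also have "\<dots> = (\<Sum>j\<in>J0. (a j)\<^sup>2) / r\<^sup>2"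
    using fin by (simp add: b_def power_divide sum_divide_distrib)
  also have "\<dots> = 1"
    using r by (simp add: r_def L2_set_def sum_nonneg)
  finally have "l2_norm J b \<le> 1" by (simp add: l2_norm_def)
  \<comment> \<open>A finite norm rules out the default value, so the image of \<open>b\<close> is
    square-summable and its finite partial sums are bounded by the infinite sum.\<close>
  have fin_op: "\<forall>a\<in>l2 J. (\<forall>i\<in>I. (\<lambda>j. e i j * a j) summable_on J) \<and> mat_op J e a \<in> l2 I"
    using S by (auto simp: mat_onorm_def split: if_splits)
  have "ereal (l2_norm I (mat_op J e b)) \<le> mat_onorm I J e"
    unfolding mat_onorm_def if_P[OF fin_op]
    by (rule SUP_upper) (use b_l2 \<open>l2_norm J b \<le> 1\<close> in simp)
  then have le: "l2_norm I (mat_op J e b) \<le> S" by (simp add: S)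
  have "L2_set (mat_op J e b) I0 \<le> l2_norm I (mat_op J e b)"
    unfolding L2_set_def l2_norm_def using fin_op b_l2 fin
    by (intro real_sqrt_le_mono finite_sum_le_infsum) (auto simp: l2_def)
  with le have "r * L2_set (mat_op J e b) I0 \<le> r * S" using r by (intro mult_left_mono) auto
  also have "r * L2_set (mat_op J e b) I0 = L2_set (\<lambda>i. \<Sum>j\<in>J0. e i j * a j) I0"
    using r by (simp add: L2_set_right_distrib op)
  finally show ?thesis by (simp add: r_def mult.commute)
qed

context prob_space
begin

section \<open>From finite families to the maximal correlation\<close>

lemma L2_triangle:
  assumes f: "f \<in> sq_integrable M M" and g: "g \<in> sq_integrable M M"
  shows "sqrt (expectation (\<lambda>x. (f x + g x)\<^sup>2))
    \<le> sqrt (expectation (\<lambda>x. (f x)\<^sup>2)) + sqrt (expectation (\<lambda>x. (g x)\<^sup>2))"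
proof -
  let ?a = "sqrt (expectation (\<lambda>x. (f x)\<^sup>2))" and ?b = "sqrt (expectation (\<lambda>x. (g x)\<^sup>2))"
  have "expectation (\<lambda>x. (f x + g x)\<^sup>2) = expectation (\<lambda>x. (f x)\<^sup>2 + (g x)\<^sup>2 + 2 * (f x * g x))"
    by (simp add: power2_eq_square algebra_simps)
  also have "\<dots> = ?a\<^sup>2 + ?b\<^sup>2 + 2 * expectation (\<lambda>x. f x * g x)"
    using sq_integrableD(2)[OF f] sq_integrableD(2)[OF g] integrable_mult_sq_integrable[OF f g] by simp
  also have "\<dots> \<le> (?a + ?b)\<^sup>2"
    using Cauchy_Schwarz_expectation[OF f g] by (simp add: power2_sum)
  finally show ?thesis by (intro real_le_lsqrt) simp_all
qed

lemma sq_integrable_center: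
  assumes "subalgebra M F" "f \<in> sq_integrable M F"
  shows "(\<lambda>x. f x - expectation f) \<in> sq_integrable M F"
  using assms by (intro sq_integrable_diff sq_integrable_const)

lemma covar_le_sd:
  assumes f: "f \<in> sq_integrable M M" and g: "g \<in> sq_integrable M M"
  shows "\<bar>covar M f g\<bar> \<le> sd M f * sd M g"
  unfolding covar_def sd_def
  using Cauchy_Schwarz_expectation[OF sq_integrable_center[OF subalgebra_self f]
      sq_integrable_center[OF subalgebra_self g]] by simp

text \<open>A bound on the elements bounds a real \<open>Sup\<close> only if the set is nonempty. If
  neither algebra is trivial, each contains an event of probability other than 0 and 1, whose
  indicator is not a.s. constant.\<close>

lemma max_corr_le:
  assumes F: "subalgebra M F" and G: "subalgebra M G" and c: "0 \<le> c"
    and le: "\<And>f g. f \<in> sq_integrable M F \<Longrightarrow> g \<in> sq_integrable M G \<Longrightarrow>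
      \<bar>covar M f g\<bar> \<le> c * sd M f * sd M g"
  shows "max_corr M F G \<le> c"
proof (cases "trivial_alg M F \<or> trivial_alg M G")
  case False
  have nonconst: "\<exists>f\<in>sq_integrable M E. \<not> as_const M f" if E: "subalgebra M E" and nt: "\<not> trivial_alg M E" for E
  proof -
    obtain A where A: "A \<in> sets E" "prob A \<noteq> 0" "prob A \<noteq> 1" using nt by (auto simp: trivial_alg_def)
    have AM: "A \<in> sets M" using E A by (auto simp: subalgebra_def)
    have "\<not> as_const M (indicator A)"
    proof
      assume "as_const M (indicator A)"
      then obtain k where k: "AE x in M. indicator A x = (k::real)" by (auto simp: as_const_def)
      then have "AE x in M. k = 0 \<or> k = 1" by eventually_elim (auto simp: indicator_def split: if_splits)
      then have "k = 0 \<or> k = 1" by simp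
      moreover have "expectation (indicator A) = expectation (\<lambda>_. k)"
        using k AM by (intro integral_cong_AE) auto
      then have "prob A = k" using AM by (simp add: prob_space)
      ultimately show False using A by simp
    qed
    then show ?thesis using sq_integrable_indicator[OF E A(1)] by blast
  qed
  let ?R = "{\<bar>covar M f g\<bar> / (sd M f * sd M g) | f g.
      f \<in> sq_integrable M F \<and> \<not> as_const M f \<and> g \<in> sq_integrable M G \<and> \<not> as_const M g}"
  have "Sup ?R \<le> c"
  proof (rule cSup_least)
    show "?R \<noteq> {}" using nonconst[OF F] nonconst[OF G] False by blast
    fix r assume "r \<in> ?R"
    then obtain f g where r: "r = \<bar>covar M f g\<bar> / (sd M f * sd M g)"
      and fg: "f \<in> sq_integrable M F" "g \<in> sq_integrable M G" by blast
    \<comment> \<open>If a deviation is 0, the quotient is 0 by the convention for division by 0,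
      and \<open>0 \<le> c\<close> covers this case.\<close>
    have "0 \<le> sd M f * sd M g" by (simp add: sd_def)
    then show "r \<le> c"
      unfolding r using le[OF fg] c by (cases "sd M f * sd M g = 0") (auto simp: divide_le_eq mult.assoc less_le)
  qed
  then show ?thesis using False by (simp add: max_corr_def)
qed (use c in \<open>auto simp: max_corr_def\<close>)

text \<open>Both sides are continuous in L2. The centred functions are replaced by functions
  \<open>h\<close>, \<open>k\<close> of finitely many variables at distance at most
  \<open>r\<close>, and \<open>r\<close> tends to 0.\<close>

lemma covar_le_of_finite_sections:
  fixes F :: "'i \<Rightarrow> 'a measure" and G :: "'j \<Rightarrow> 'a measure"
  assumes F: "\<And>i. i \<in> I \<Longrightarrow> sets (F i) \<subseteq> sets M" and G: "\<And>j. j \<in> J \<Longrightarrow> sets (G j) \<subseteq> sets M"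
    and s: "0 \<le> s"
    and fin: "\<And>I0 J0 h k. finite I0 \<Longrightarrow> I0 \<subseteq> I \<Longrightarrow> finite J0 \<Longrightarrow> J0 \<subseteq> J \<Longrightarrow>
      h \<in> sq_integrable M (join_alg M I0 F) \<Longrightarrow> k \<in> sq_integrable M (join_alg M J0 G) \<Longrightarrow>
      expectation k = 0 \<Longrightarrow>
      \<bar>expectation (\<lambda>x. h x * k x)\<bar>
        \<le> s * sqrt (expectation (\<lambda>x. (h x)\<^sup>2)) * sqrt (expectation (\<lambda>x. (k x)\<^sup>2))"
    and f: "f \<in> sq_integrable M (join_alg M I F)" and g: "g \<in> sq_integrable M (join_alg M J G)"
  shows "\<bar>covar M f g\<bar> \<le> s * sd M f * sd M g"
proof -
  define n where "n f = sqrt (expectation (\<lambda>x. (f x)\<^sup>2))" for f :: "'a \<Rightarrow> real"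
  define f' g' where "f' = (\<lambda>x. f x - expectation f)" and "g' = (\<lambda>x. g x - expectation g)"
  have FM: "subalgebra M (join_alg M I F)" and GM: "subalgebra M (join_alg M J G)"
    by (intro subalgebra_join_alg F G; assumption)+
  have f': "f' \<in> sq_integrable M (join_alg M I F)" and g': "g' \<in> sq_integrable M (join_alg M J G)"
    unfolding f'_def g'_def by (intro sq_integrable_center FM GM f g)+
  note f'M = sq_integrable_mono[OF FM f'] and g'M = sq_integrable_mono[OF GM g']
  have bound: "\<bar>expectation (\<lambda>x. f' x * g' x)\<bar>
      \<le> r * n g' + (n f' + r) * r + s * (n f' + r) * (n g' + r)" if r: "0 < r" for r
  proof -
    have r2: "0 < r\<^sup>2" using r by simp
    obtain I0 h where I0: "finite I0" "I0 \<subseteq> I" and h: "h \<in> sq_integrable M (join_alg M I0 F)"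
      and dh: "expectation (\<lambda>x. (f' x - h x)\<^sup>2) < r\<^sup>2"
      using L2_approximableE[OF L2_approximable_all[OF F f'] r2] .
    obtain J0 k' where J0: "finite J0" "J0 \<subseteq> J" and k': "k' \<in> sq_integrable M (join_alg M J0 G)"
      and dk': "expectation (\<lambda>x. (g' x - k' x)\<^sup>2) < r\<^sup>2"
      using L2_approximableE[OF L2_approximable_all[OF G g'] r2] .
    have IM: "subalgebra M (join_alg M I0 F)" and JM: "subalgebra M (join_alg M J0 G)"
      using subalgebra_join_alg_subset[OF F I0(2)] subalgebra_join_alg_subset[OF G J0(2)] by auto
    \<comment> \<open>The finite case asks for mean 0. Centring does not spoil the approximation:
      \<open>g' - k\<close> is \<open>g' - k'\<close> minus its mean, and a variance is at most the
      second moment.\<close>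
    define k where "k = (\<lambda>x. k' x - expectation k')"
    have k: "k \<in> sq_integrable M (join_alg M J0 G)"
      unfolding k_def by (rule sq_integrable_center[OF JM k'])
    note hM = sq_integrable_mono[OF IM h] and kM = sq_integrable_mono[OF JM k]
      and k'M = sq_integrable_mono[OF JM k']
    have k0: "expectation k = 0" using sq_integrableD(3)[OF k'M] by (simp add: k_def prob_space)
    have g'0: "expectation g' = 0"
      using sq_integrableD(3)[OF sq_integrable_mono[OF GM g]] by (simp add: g'_def prob_space)
    have fhM: "(\<lambda>x. f' x - h x) \<in> sq_integrable M M" and gkM: "(\<lambda>x. g' x - k x) \<in> sq_integrable M M"
      and gk'M: "(\<lambda>x. g' x - k' x) \<in> sq_integrable M M"
      by (intro sq_integrable_diff subalgebra_self f'M g'M hM kM k'M)+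
    have nfh: "n (\<lambda>x. f' x - h x) \<le> r"
      unfolding n_def using dh r by (intro real_le_lsqrt) auto
    have ngk: "n (\<lambda>x. g' x - k x) \<le> r"
    proof -
      let ?D = "\<lambda>x. g' x - k' x"
      have "expectation ?D = - expectation k'"
        using sq_integrableD(3)[OF g'M] sq_integrableD(3)[OF k'M] g'0 by simp
      then have "expectation (\<lambda>x. (g' x - k x)\<^sup>2) = variance ?D"
        by (simp add: k_def algebra_simps)
      also have "\<dots> = expectation (\<lambda>x. (?D x)\<^sup>2) - (expectation ?D)\<^sup>2"
        using sq_integrableD(2,3)[OF gk'M] by (intro variance_eq)
      also have "\<dots> \<le> r\<^sup>2" using dk' by (smt (verit) zero_le_power2)
      finally show ?thesis unfolding n_def using r by (intro real_le_lsqrt) auto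
    qed
    have nonneg: "0 \<le> n u" for u by (simp add: n_def)
    have nh: "n h \<le> n f' + r"
    proof -
      have "n (\<lambda>x. f' x + (- 1) * (f' x - h x)) \<le> n f' + n (\<lambda>x. (- 1) * (f' x - h x))"
        unfolding n_def by (intro L2_triangle f'M sq_integrable_cmult fhM)
      then show ?thesis using nfh by (simp add: n_def power2_commute)
    qed
    have nk: "n k \<le> n g' + r"
    proof -
      have "n (\<lambda>x. g' x + (- 1) * (g' x - k x)) \<le> n g' + n (\<lambda>x. (- 1) * (g' x - k x))"
        unfolding n_def by (intro L2_triangle g'M sq_integrable_cmult gkM)
      then show ?thesis using ngk by (simp add: n_def power2_commute)
    qed
    \<comment> \<open>The first two terms of this splitting are approximation errors; the finite
      case applies to the third.\<close>
    have "expectation (\<lambda>x. f' x * g' x)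
      = expectation (\<lambda>x. (f' x - h x) * g' x + h x * (g' x - k x) + h x * k x)"
      by (simp add: algebra_simps)
    also have "\<dots> = expectation (\<lambda>x. (f' x - h x) * g' x) + expectation (\<lambda>x. h x * (g' x - k x))
        + expectation (\<lambda>x. h x * k x)"
      using integrable_mult_sq_integrable[OF fhM g'M] integrable_mult_sq_integrable[OF hM gkM]
        integrable_mult_sq_integrable[OF hM kM] by simp
    finally have "\<bar>expectation (\<lambda>x. f' x * g' x)\<bar> \<le> \<bar>expectation (\<lambda>x. (f' x - h x) * g' x)\<bar>
        + \<bar>expectation (\<lambda>x. h x * (g' x - k x))\<bar> + \<bar>expectation (\<lambda>x. h x * k x)\<bar>" by linarith
    also have "\<dots> \<le> n (\<lambda>x. f' x - h x) * n g' + n h * n (\<lambda>x. g' x - k x) + s * n h * n k"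
      unfolding n_def
      by (intro add_mono Cauchy_Schwarz_expectation fhM g'M hM gkM fin[OF I0 J0 h k k0])
    also have "\<dots> \<le> r * n g' + (n f' + r) * r + s * (n f' + r) * (n g' + r)"
      using nfh ngk nh nk nonneg s r by (intro add_mono mult_mono) auto
    finally show ?thesis .
  qed
  \<comment> \<open>As \<open>r\<close> decreases to 0, only \<open>s * n f' * n g'\<close> survives
    in the bound.\<close>
  have "((\<lambda>r. r * n g' + (n f' + r) * r + s * (n f' + r) * (n g' + r))
      \<longlongrightarrow> 0 * n g' + (n f' + 0) * 0 + s * (n f' + 0) * (n g' + 0)) (at_right 0)"
    by (intro tendsto_intros)
  then have "\<bar>expectation (\<lambda>x. f' x * g' x)\<bar> \<le> 0 * n g' + (n f' + 0) * 0 + s * (n f' + 0) * (n g' + 0)"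
    by (rule tendsto_lowerbound) (use bound in \<open>auto simp: eventually_at_right_field intro!: exI[of _ 1]\<close>)
  then show ?thesis by (simp add: covar_def sd_def n_def f'_def g'_def)
qed

end

section \<open>Random vectors and the final bound\<close>

text \<open>The product algebra is generated by the coordinates, and each coordinate of the vector
  is measurable for the join. Functions of the vector can therefore be approximated by functions of
  finitely many coordinates.\<close>

lemma subalgebra_join_alg_vimage_PiM:
  assumes X: "\<And>i. i \<in> I \<Longrightarrow> X i \<in> measurable M (N i)"
  shows "subalgebra (join_alg M I (\<lambda>i. vimage_algebra (space M) (X i) (N i)))
    (vimage_algebra (space M) (\<lambda>\<omega>. \<lambda>i\<in>I. X i \<omega>) (\<Pi>\<^sub>M i\<in>I. N i))"
proof -
  let ?F = "\<lambda>i. vimage_algebra (space M) (X i) (N i)"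
  have F: "sets (?F i) \<subseteq> sets M" if "i \<in> I" for i
    by (rule sets_image_in_sets[OF refl X[OF that]])
  have "X i \<in> measurable (join_alg M I ?F) (N i)" if i: "i \<in> I" for i
  proof (rule measurableI)
    fix A assume "A \<in> sets (N i)"
    then have "X i -` A \<inter> space M \<in> sets (?F i)" by (rule in_vimage_algebra)
    then show "X i -` A \<inter> space (join_alg M I ?F) \<in> sets (join_alg M I ?F)"
      using i sets_join_alg[of I ?F M] F by auto
  qed (use measurable_space[OF X[OF i]] in simp)
  then have "(\<lambda>\<omega>. \<lambda>i\<in>I. X i \<omega>) \<in> measurable (join_alg M I ?F) (\<Pi>\<^sub>M i\<in>I. N i)"
    by (rule measurable_restrict)
  then have "sets (vimage_algebra (space M) (\<lambda>\<omega>. \<lambda>i\<in>I. X i \<omega>) (\<Pi>\<^sub>M i\<in>I. N i)) \<subseteq> sets (join_alg M I ?F)"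
    by (intro sets_image_in_sets) simp_all
  then show ?thesis by (simp add: subalgebra_def)
qed

theorem theorem3p3p1:
  fixes M :: "'a measure"
    and I :: "'i set" and J :: "'j set"
    and X :: "'i \<Rightarrow> 'a \<Rightarrow> 'b" and NX :: "'i \<Rightarrow> 'b measure"
    and Y :: "'j \<Rightarrow> 'a \<Rightarrow> 'c" and NY :: "'j \<Rightarrow> 'c measure"
    and \<epsilon> :: "'i \<Rightarrow> 'j \<Rightarrow> real"
  defines "\<sigma>X \<equiv> \<lambda>i. vimage_algebra (space M) (X i) (NX i)"
    and "\<sigma>Y \<equiv> \<lambda>j. vimage_algebra (space M) (Y j) (NY j)"
  defines "\<M> \<equiv> metalgebra M (I <+> J) (case_sum \<sigma>X \<sigma>Y)"
  assumes "prob_space M"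
    and "\<And>i. i \<in> I \<Longrightarrow> X i \<in> measurable M (NX i)"
    and "\<And>j. j \<in> J \<Longrightarrow> Y j \<in> measurable M (NY j)"
    and "\<And>i j. i \<in> I \<Longrightarrow> j \<in> J \<Longrightarrow> 0 \<le> \<epsilon> i j"
    and "\<And>i j. i \<in> I \<Longrightarrow> j \<in> J \<Longrightarrow> meta_corr M \<M> (\<sigma>X i) (\<sigma>Y j) \<le> \<epsilon> i j"
  shows "ereal (max_corr M
             (vimage_algebra (space M) (\<lambda>\<omega>. \<lambda>i\<in>I. X i \<omega>) (\<Pi>\<^sub>M i\<in>I. NX i))
             (vimage_algebra (space M) (\<lambda>\<omega>. \<lambda>j\<in>J. Y j \<omega>) (\<Pi>\<^sub>M j\<in>J. NY j)))
         \<le> min (mat_onorm I J \<epsilon>) 1"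
proof -
  interpret prob_space M by fact
  note X = assms(5) and Y = assms(6) and eps = assms(7) and corr = assms(8)
  define FX where "FX = vimage_algebra (space M) (\<lambda>\<omega>. \<lambda>i\<in>I. X i \<omega>) (\<Pi>\<^sub>M i\<in>I. NX i)"
  define GY where "GY = vimage_algebra (space M) (\<lambda>\<omega>. \<lambda>j\<in>J. Y j \<omega>) (\<Pi>\<^sub>M j\<in>J. NY j)"
  have sX: "sets (\<sigma>X i) \<subseteq> sets M" if "i \<in> I" for i
    unfolding \<sigma>X_def by (rule sets_image_in_sets[OF refl X[OF that]])
  have sY: "sets (\<sigma>Y j) \<subseteq> sets M" if "j \<in> J" for j
    unfolding \<sigma>Y_def by (rule sets_image_in_sets[OF refl Y[OF that]])
  have FX: "subalgebra (join_alg M I \<sigma>X) FX"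
    unfolding \<sigma>X_def FX_def by (rule subalgebra_join_alg_vimage_PiM[OF X])
  have GY: "subalgebra (join_alg M J \<sigma>Y) GY"
    unfolding \<sigma>Y_def GY_def by (rule subalgebra_join_alg_vimage_PiM[OF Y])
  have FX_M: "subalgebra M FX"
    using FX subalgebra_join_alg[of I \<sigma>X M] sX by (auto simp: subalgebra_def)
  have GY_M: "subalgebra M GY"
    using GY subalgebra_join_alg[of J \<sigma>Y M] sY by (auto simp: subalgebra_def)
  have H_M: "subalgebra M H" if H: "H \<in> \<M>" for H
  proof -
    obtain K where K: "K \<subseteq> I <+> J" "H = join_alg M K (case_sum \<sigma>X \<sigma>Y)"
      using H by (auto simp: \<M>_def metalgebra_def)
    have "sets (case_sum \<sigma>X \<sigma>Y k) \<subseteq> sets M" if "k \<in> K" for k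
      using that K(1) by (cases k) (auto dest!: subsetD[of K] dest: sX[THEN subsetD] sY[THEN subsetD])
    then show ?thesis unfolding K(2) by (rule subalgebra_join_alg)
  qed
  have subj: "subj_corr M H (\<sigma>X i) (\<sigma>Y j) \<le> \<epsilon> i j" if ij: "i \<in> I" "j \<in> J" and H: "H \<in> \<M>" for i j H
  proof -
    \<comment> \<open>A real supremum dominates its members only when the set is bounded above; here
      1 is a bound.\<close>
    have "bdd_above ((\<lambda>H. subj_corr M H (\<sigma>X i) (\<sigma>Y j)) ` \<M>)"
      using subj_corr_props(2)[OF H_M sX[OF ij(1)] sY[OF ij(2)]] by (intro bdd_aboveI2)
    then have "subj_corr M H (\<sigma>X i) (\<sigma>Y j) \<le> meta_corr M \<M> (\<sigma>X i) (\<sigma>Y j)"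
      unfolding meta_corr_def using H by (intro cSUP_upper)
    also have "\<dots> \<le> \<epsilon> i j" by (rule corr[OF ij])
    finally show ?thesis .
  qed
  have le1: "max_corr M FX GY \<le> 1"
  proof (rule max_corr_le[OF FX_M GY_M])
    fix f g assume f: "f \<in> sq_integrable M FX" and g: "g \<in> sq_integrable M GY"
    show "\<bar>covar M f g\<bar> \<le> 1 * sd M f * sd M g"
      unfolding mult_1
      by (rule covar_le_sd[OF sq_integrable_mono[OF FX_M f] sq_integrable_mono[OF GY_M g]])
  qed simp
  \<comment> \<open>The strict gap between \<open>S\<close> and \<open>s\<close> is what
    \<open>schur_weights\<close> consumes, and \<open>s < 1\<close> keeps the column weights at most
    1 in \<open>grid_bound\<close>.\<close>
  have leS: "max_corr M FX GY \<le> s" if S: "mat_onorm I J \<epsilon> = ereal S" and s: "S < s" "s < 1" for S s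
  proof -
    have S0: "0 \<le> S" using mat_onorm_nonneg[of I J \<epsilon>] by (simp add: S)
    show ?thesis
    proof (rule max_corr_le[OF FX_M GY_M])
      fix f g assume f: "f \<in> sq_integrable M FX" and g: "g \<in> sq_integrable M GY"
      show "\<bar>covar M f g\<bar> \<le> s * sd M f * sd M g"
      proof (rule covar_le_of_finite_sections[where F = \<sigma>X and G = \<sigma>Y and I = I and J = J])
        fix I0 J0 h k
        assume fin: "finite I0" "I0 \<subseteq> I" "finite J0" "J0 \<subseteq> J"
          and h: "h \<in> sq_integrable M (join_alg M I0 \<sigma>X)"
          and k: "k \<in> sq_integrable M (join_alg M J0 \<sigma>Y)" "expectation k = 0"
        have sX0: "sets (\<sigma>X i) \<subseteq> sets M" if "i \<in> I0" for i
          by (rule sX[OF subsetD[OF fin(2) that]])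
        have sY0: "sets (\<sigma>Y j) \<subseteq> sets M" if "j \<in> J0" for j
          by (rule sY[OF subsetD[OF fin(4) that]])
        have eps0: "0 \<le> \<epsilon> i j" if "i \<in> I0" "j \<in> J0" for i j
          using that fin eps by blast
        obtain u v where v: "\<And>j. j \<in> J0 \<Longrightarrow> 0 < v j"
          and u: "\<And>i. i \<in> I0 \<Longrightarrow> (\<Sum>j\<in>J0. \<epsilon> i j * v j) < s * u i"
          and uv: "\<And>j. j \<in> J0 \<Longrightarrow> (\<Sum>i\<in>I0. \<epsilon> i j * u i) \<le> s * v j"
          by (rule schur_weights[OF fin(1,3) eps0 mat_onorm_finite_section[OF S fin] S0 s(1)]) (assumption | rule that)+
        show "\<bar>expectation (\<lambda>x. h x * k x)\<bar>
            \<le> s * sqrt (expectation (\<lambda>x. (h x)\<^sup>2)) * sqrt (expectation (\<lambda>x. (k x)\<^sup>2))"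
        proof (rule finite_tensorization[OF fin(1,3) _ _ _ _ _ _ v u uv h k])
          fix i j K p q
          assume ij: "i \<in> I0" "j \<in> J0" and K: "K \<subseteq> I0 <+> J0"
            and p: "p \<in> sq_integrable M (join2_alg M (\<sigma>X i) (join_alg M K (case_sum \<sigma>X \<sigma>Y)))"
            and q: "q \<in> sq_integrable M (join2_alg M (\<sigma>Y j) (join_alg M K (case_sum \<sigma>X \<sigma>Y)))"
            and z: "AE x in M. real_cond_exp M (join_alg M K (case_sum \<sigma>X \<sigma>Y)) p x = 0"
              "AE x in M. real_cond_exp M (join_alg M K (case_sum \<sigma>X \<sigma>Y)) q x = 0"
          have IJ: "i \<in> I" "j \<in> J" using ij fin by auto
          \<comment> \<open>The algebras revealed inside a finite section are spanned by a subfamily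
            of the whole family, so the hypothesis on the metalgebra covers them.\<close>
          have H: "join_alg M K (case_sum \<sigma>X \<sigma>Y) \<in> \<M>"
            using K fin unfolding \<M>_def metalgebra_def by blast
          have "\<bar>expectation (\<lambda>x. p x * q x)\<bar>
              \<le> subj_corr M (join_alg M K (case_sum \<sigma>X \<sigma>Y)) (\<sigma>X i) (\<sigma>Y j) * sd M p * sd M q"
            by (rule subj_corr_props(3)[OF H_M[OF H] sX[OF IJ(1)] sY[OF IJ(2)] p q z])
          also have "\<dots> \<le> \<epsilon> i j * sd M p * sd M q"
            using subj[OF IJ H] by (intro mult_right_mono) (auto simp: sd_def)
          finally show "\<bar>expectation (\<lambda>x. p x * q x)\<bar> \<le> \<epsilon> i j * sd M p * sd M q" .
        qed (use sX0 sY0 eps0 s S0 in simp_all)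
      next
        show "f \<in> sq_integrable M (join_alg M I \<sigma>X)" by (rule sq_integrable_mono[OF FX f])
        show "g \<in> sq_integrable M (join_alg M J \<sigma>Y)" by (rule sq_integrable_mono[OF GY g])
      qed (use sX sY s S0 in simp_all)
    qed (use s S0 in simp)
  qed
  have "ereal (max_corr M FX GY) \<le> mat_onorm I J \<epsilon>"
  \<comment> \<open>Below 1 the norm is a real number \<open>S\<close>, approached by values
    \<open>s\<close> in \<open>{S<..<1}\<close>. Otherwise, including the infinite case, the trivial
    bound 1 is enough.\<close>
  proof (cases "mat_onorm I J \<epsilon> < 1")
    case True
    then obtain S where S: "mat_onorm I J \<epsilon> = ereal S"
      using mat_onorm_nonneg[of I J \<epsilon>] by (cases "mat_onorm I J \<epsilon>") auto
    then have "S < 1" using True by simp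
    then have "max_corr M FX GY \<le> S" by (rule dense_ge_bounded) (rule leS[OF S])
    then show ?thesis by (simp add: S)
  next
    case False
    have "ereal (max_corr M FX GY) \<le> 1" using le1 by (simp add: one_ereal_def)
    also have "1 \<le> mat_onorm I J \<epsilon>" using False by simp
    finally show ?thesis .
  qed
  moreover have "ereal (max_corr M FX GY) \<le> 1" using le1 by (simp add: one_ereal_def)
  ultimately show ?thesis unfolding FX_def GY_def by (rule min.boundedI)
qed

end
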